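(* Let $a,b\ge 0$ be integers, let $\nu$ be a lattice path from $(0,0)$ to $(a,b)$ with steps $E=(1,0)$ and $N=(0,1)$, and let $w$ be the number of valleys (occurrences of two consecutive letters $EN$) in $\overline{\nu}=E\nu N$. Then the flow polytope $\mathcal{F}_{\widetilde{G}_B(\nu)}$ can be written as $$\mathcal{F}_{\widetilde{G}_B(\nu)}=\bigcup_{i=1}^{w}\mathcal{Q}_i,$$ where the polytopes $\mathcal{Q}_1,\dots,\mathcal{Q}_w$ have pairwise disjoint interiors. Furthermore, for every nonempty $S\subseteq[w]$, the polytope $\bigcap_{i\in S}\mathcal{Q}_i$ is integrally equivalent to the flow polytope $\mathcal{F}_{\bigcap_{i\in S}\widetilde{G}(\nu,i)}$.
   Context: Generalized flow polytopes. Let $G$ be a finite connected graph on a totally ordered vertex set whose (multi)edges join two distinct vertices $i<j$ and are of one of three types: forward $(i,j,+)$ (may be traversed from $i$ to $j$; flow $x_e\ge 0$), backward $(i,j,-)$ (may be traversed from $j$ to $i$; flow $x_e\le 0$), or bidirectional $(i,j,\pm)$ (may be traversed either way; $x_e\in\mathbb{R}$). For a vertex $j$ let $S(j)$ be the set of edges $\{i,j\}$ with $i<j$ and $L(j)$ the set of edges $\{j,k\}$ with $j<k$. With the smallest vertex the source and the largest the sink, a unit flow is a vector $(x_e)_{e\in E(G)}\in\mathbb{R}^{E(G)}$ satisfying the sign conditions above and $\sum_{e\in L(j)}x_e-\sum_{e\in S(j)}x_e$ equal to $1$ at the source, $-1$ at the sink and $0$ at every other vertex. $\mathcal{F}_G$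 denotes the set of unit flows. A route is a directed path from source to sink traversing each edge in an allowed direction; its signed characteristic vector $x_R$ has $x_e=1$ if $R$ traverses $e=\{i,j\}$, $i<j$, from $i$ to $j$, $x_e=-1$ if from $j$ to $i$, and $0$ if $e\notin R$. Integral equivalence: lattice polytopes $P\subseteq\mathbb{R}^k$, $Q\subseteq\mathbb{R}^\ell$ are integrally equivalent if there is an affine map $\varphi:\mathbb{R}^k\to\mathbb{R}^\ell$ restricting to a bijection $P\to Q$ and to a bijection $\mathbb{Z}^k\cap\mathrm{aff}(P)\to\mathbb{Z}^\ell\cap\mathrm{aff}(Q)$. The path data. Canonical indexing of $\overline{\nu}$: reading left to right, each letter receives the next positive integer as index, except that an $N$ step immediately preceded by an $E$ step receives the same index as that $E$ step (e.g. $ENEENNEN$ is indexed $E_1N_1E_2E_3N_3N_4E_5N_5$). Let $n$ be the largest index, $I$ the set of indices of $E$ steps, $J$ the set of indices of $N$ steps; then $|I|=a+1$, $|J|=b+1$, and $I\cap J=\{v_1<v_2<\dots<v_w\}$ indexes the valleys. The graph $G(\nu)$ has vertex set $[n]$ and, for $i\in I$, $j\in J$, $i<j$, a forward edge $(i,j,+)$ if and only if every occurrence of two consecutive letters $EN$ inside the contiguous factor $E_i\cdots N_j$ of $\overline{\nu}$ is of the form $E_kN_k$ with $k\in\{i,j\}$. The graph $G_B(\nu)$ is $G(\nu)$ with each edge $(i,j)$ having $i,j\in I\cap J$ (these are the edges $(v_k,v_{k+1})$) made bidirectional. For $1\le i<w$, $G(\nu,i)$ is obtained from $G(\nu)$ by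 deleting the edge $(v_i,v_{i+1},+)$ and adding the backward edge $(v_1,v_w,-)$ (directed from $v_w$ to $v_1$); $G(\nu,w)=G(\nu)$. For any such graph $H$ on $[n]$, its partial augmentation $\widetilde{H}$ is obtained by adding a source $s$ and sink $t$ (ordered $s<1<\dots<n<t$) and the forward edges $(s,i)$ for $i\in I$ and $(j,t)$ for $j\in J$. The intersection $\bigcap_{i\in S}\widetilde{G}(\nu,i)$ is the graph on $\{s,1,\dots,n,t\}$ consisting of the edges (with their directions) common to all $\widetilde{G}(\nu,i)$, $i\in S$. The cells. All the polytopes below lie in $\mathbb{R}^{E(\widetilde{G}_B(\nu))}$. For $1\le i<w$, $\mathcal{Q}_i$ is the convex hull of the signed characteristic vectors of those routes $R$ of $\widetilde{G}_B(\nu)$ that do not traverse the edge $\{v_i,v_{i+1}\}$ from $v_i$ to $v_{i+1}$ and such that, if $R$ traverses some edge from its larger to its smaller endpoint, then $R$ traverses $\{v_i,v_{i+1}\}$ from $v_{i+1}$ to $v_i$. Also $\mathcal{Q}_w=\mathcal{F}_{\widetilde{G}(\nu)}$, i.e. the convex hull of the routes of $\widetilde{G}_B(\nu)$ traversing every edge from smaller to larger endpoint. *)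

theory Defs
  imports
    "HOL-Analysis.Analysis"
    "HOL-Analysis.Finite_Function_Topology"
    "Graph_Theory.Arc_Walk"
begin

section \<open>Generalized flow polytopes\<close>

text \<open>
  An edge \<open>(i, j, d)\<close> joins \<open>i < j\<close>. A graph is given by its vertex set \<open>V\<close> and its edge set \<open>H\<close>,
  so parallel edges of different types are possible. (Parallel edges of the same type do not occur
  in the graphs considered below.)
\<close>

datatype edge_type = Fwd | Bwd | Bidir

type_synonym 'v edge = "'v \<times> 'v \<times> edge_type"

abbreviation lo :: "'v edge \<Rightarrow> 'v" where "lo e \<equiv> fst e"
abbreviation hi :: "'v edge \<Rightarrow> 'v" where "hi e \<equiv> fst (snd e)"
abbreviation etype :: "'v edge \<Rightarrow> edge_type" where "etype e \<equiv> snd (snd e)"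

text \<open>
  For a set \<open>K\<close> of coordinates, the space of real vectors indexed by \<open>K\<close> is rendered as the subspace
  \<open>coord_space K\<close> of the normed space of finitely supported functions. In this way the flow
  polytopes of all graphs have the same type, and on \<open>coord_space K\<close> with \<open>K\<close> finite the topology is
  the Euclidean one.
\<close>

definition coord_space :: "'e set \<Rightarrow> ('e \<Rightarrow>\<^sub>0 real) set" where
  "coord_space K = {x. Poly_Mapping.keys x \<subseteq> K}"

definition sign_ok :: "edge_type \<Rightarrow> real \<Rightarrow> bool" where
  "sign_ok d r = (case d of Fwd \<Rightarrow> r \<ge> 0 | Bwd \<Rightarrow> r \<le> 0 | Bidir \<Rightarrow> True)"

definition netflow :: "'v edge set \<Rightarrow> ('v edge \<Rightarrow>\<^sub>0 real) \<Rightarrow> 'v \<Rightarrow> real" where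
  "netflow H x j =
     (\<Sum>e\<in>{e\<in>H. lo e = j}. Poly_Mapping.lookup x e) - (\<Sum>e\<in>{e\<in>H. hi e = j}. Poly_Mapping.lookup x e)"

definition flow_polytope :: "'v::linorder set \<Rightarrow> 'v edge set \<Rightarrow> ('v edge \<Rightarrow>\<^sub>0 real) set" where
  "flow_polytope V H =
     {x \<in> coord_space H.
        (\<forall>e\<in>H. sign_ok (etype e) (Poly_Mapping.lookup x e)) \<and>
        (\<forall>j\<in>V. netflow H x j = (if j = Min V then 1 else if j = Max V then - 1 else 0))}"

text \<open>
  A dart \<open>(e, b)\<close> is a traversal of the edge \<open>e\<close>: from its smaller to its larger endpoint if \<open>b\<close>,
  and from its larger to its smaller endpoint otherwise.
\<close>

type_synonym 'v dart = "'v edge \<times> bool"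

definition allowed :: "'v dart \<Rightarrow> bool" where
  "allowed = (\<lambda>(e, b). case etype e of Fwd \<Rightarrow> b | Bwd \<Rightarrow> \<not> b | Bidir \<Rightarrow> True)"

definition dart_digraph :: "'v set \<Rightarrow> 'v edge set \<Rightarrow> ('v, 'v dart) pre_digraph" where
  "dart_digraph V H =
     \<lparr> verts = V,
       arcs = {(e, b). e \<in> H \<and> allowed (e, b)},
       tail = (\<lambda>(e, b). if b then lo e else hi e),
       head = (\<lambda>(e, b). if b then hi e else lo e) \<rparr>"

definition routes :: "'v::linorder set \<Rightarrow> 'v edge set \<Rightarrow> 'v dart list set" where
  "routes V H = {R. pre_digraph.apath (dart_digraph V H) (Min V) R (Max V)}"

definition char_vec :: "'v dart list \<Rightarrow> ('v edge \<Rightarrow>\<^sub>0 real)" where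
  "char_vec R = Abs_poly_mapping
     (\<lambda>e. if (e, True) \<in> set R then 1 else if (e, False) \<in> set R then - 1 else 0)"

lemma lookup_char_vec:
  "Poly_Mapping.lookup (char_vec R) e =
     (if (e, True) \<in> set R then 1 else if (e, False) \<in> set R then - 1 else 0)"
proof -
  let ?f = "\<lambda>e. if (e, True) \<in> set R then 1 else if (e, False) \<in> set R then - 1 else (0::real)"
  have "{e. ?f e \<noteq> 0} \<subseteq> fst ` set R"
    by (force split: if_splits)
  then have "finite {e. ?f e \<noteq> 0}"
    by (rule finite_subset) simp
  then show ?thesis
    by (simp add: char_vec_def)
qed

section \<open>Integral equivalence\<close>

definition integral_points :: "('e \<Rightarrow>\<^sub>0 real) set" where
  "integral_points = {x. \<forall>e. Poly_Mapping.lookup x e \<in> \<int>}"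

definition lattice_polytope :: "('e \<Rightarrow>\<^sub>0 real) set \<Rightarrow> bool" where
  "lattice_polytope P \<longleftrightarrow> (\<exists>X. finite X \<and> X \<subseteq> integral_points \<and> P = convex hull X)"

definition affine_map :: "('a::real_vector \<Rightarrow> 'b::real_vector) \<Rightarrow> bool" where
  "affine_map \<phi> \<longleftrightarrow> (\<exists>f c. linear f \<and> \<phi> = (\<lambda>x. f x + c))"

text \<open>
  Every affine map between two coordinate subspaces extends to the spaces of all finitely supported
  functions, so there is no need to mention the coordinate sets of \<open>P\<close> and \<open>Q\<close>.
\<close>

definition integrally_equivalent :: "('e \<Rightarrow>\<^sub>0 real) set \<Rightarrow> ('f \<Rightarrow>\<^sub>0 real) set \<Rightarrow> bool" where
  "integrally_equivalent P Q \<longleftrightarrow>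
     lattice_polytope P \<and> lattice_polytope Q \<and>
     (\<exists>\<phi>. affine_map \<phi> \<and> bij_betw \<phi> P Q \<and>
          bij_betw \<phi> (integral_points \<inter> affine hull P) (integral_points \<inter> affine hull Q))"

section \<open>The graphs of a lattice path\<close>

datatype step = East | North

definition lattice_path :: "nat \<Rightarrow> nat \<Rightarrow> step list \<Rightarrow> bool" where
  "lattice_path a b \<nu> \<longleftrightarrow> count_list \<nu> East = a \<and> count_list \<nu> North = b"

definition bar :: "step list \<Rightarrow> step list" where
  "bar \<nu> = East # \<nu> @ [North]"

text \<open>\<open>EN_at u p\<close>: the letters of \<open>u\<close> at the (0-based) positions \<open>p, p + 1\<close> are \<open>E, N\<close>.\<close>

definition EN_at :: "step list \<Rightarrow> nat \<Rightarrow> bool" where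
  "EN_at u p \<longleftrightarrow> Suc p < length u \<and> u ! p = East \<and> u ! Suc p = North"

definition num_valleys :: "step list \<Rightarrow> nat" where
  "num_valleys \<nu> = card {p. EN_at (bar \<nu>) p}"

text \<open>\<open>index u p\<close> is the canonical index of the letter of \<open>u\<close> at position \<open>p\<close>.\<close>

primrec index :: "step list \<Rightarrow> nat \<Rightarrow> nat" where
  "index u 0 = 1"
| "index u (Suc p) = (if EN_at u p then index u p else Suc (index u p))"

definition max_index :: "step list \<Rightarrow> nat" where
  "max_index \<nu> = Max {index (bar \<nu>) p | p. p < length (bar \<nu>)}"

definition I_set :: "step list \<Rightarrow> nat set" where
  "I_set \<nu> = {index (bar \<nu>) p | p. p < length (bar \<nu>) \<and> bar \<nu> ! p = East}"

definition J_set :: "step list \<Rightarrow> nat set" where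
  "J_set \<nu> = {index (bar \<nu>) p | p. p < length (bar \<nu>) \<and> bar \<nu> ! p = North}"

text \<open>The valleys are numbered from 1.\<close>

definition valley :: "step list \<Rightarrow> nat \<Rightarrow> nat" where
  "valley \<nu> k = sorted_list_of_set (I_set \<nu> \<inter> J_set \<nu>) ! (k - 1)"

definition G_edges :: "step list \<Rightarrow> nat edge set" where
  "G_edges \<nu> = {(i, j, Fwd) | i j. i < j \<and>
     (\<exists>p q. p < length (bar \<nu>) \<and> bar \<nu> ! p = East \<and> index (bar \<nu>) p = i \<and>
            q < length (bar \<nu>) \<and> bar \<nu> ! q = North \<and> index (bar \<nu>) q = j \<and>
            (\<forall>r. p \<le> r \<and> Suc r \<le> q \<and> EN_at (bar \<nu>) r \<longrightarrow>
                 (\<exists>k\<in>{i, j}. index (bar \<nu>) r = k \<and> index (bar \<nu>) (Suc r) = k)))}"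

definition GB_edges :: "step list \<Rightarrow> nat edge set" where
  "GB_edges \<nu> = {(i, j, if i \<in> I_set \<nu> \<inter> J_set \<nu> \<and> j \<in> I_set \<nu> \<inter> J_set \<nu> then Bidir else Fwd) | i j.
     (i, j, Fwd) \<in> G_edges \<nu>}"

definition Gi_edges :: "step list \<Rightarrow> nat \<Rightarrow> nat edge set" where
  "Gi_edges \<nu> i =
     (if i < num_valleys \<nu>
      then (G_edges \<nu> - {(valley \<nu> i, valley \<nu> (i + 1), Fwd)})
           \<union> {(valley \<nu> 1, valley \<nu> (num_valleys \<nu>), Bwd)}
      else G_edges \<nu>)"

text \<open>In the augmented graphs the source \<open>s\<close> is 0 and the sink \<open>t\<close> is \<open>max_index \<nu> + 1\<close>.\<close>

definition aug_verts :: "step list \<Rightarrow> nat set" where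
  "aug_verts \<nu> = {0..max_index \<nu> + 1}"

definition aug_edges :: "step list \<Rightarrow> nat edge set \<Rightarrow> nat edge set" where
  "aug_edges \<nu> H = H \<union> {(0, i, Fwd) | i. i \<in> I_set \<nu>}
                     \<union> {(j, max_index \<nu> + 1, Fwd) | j. j \<in> J_set \<nu>}"

section \<open>The cells\<close>

text \<open>
  For \<open>i < num_valleys \<nu>\<close> the cell is a convex hull of routes of the augmented bidirectional graph.
  The last cell is the flow polytope of the augmented graph of \<open>G_edges \<nu>\<close>, viewed in the
  coordinates of the augmented bidirectional graph: the coordinates \<open>(i, j, Bidir)\<close> and
  \<open>(i, j, Fwd)\<close> of the two graphs are identified.
\<close>

definition cell_routes :: "step list \<Rightarrow> nat \<Rightarrow> nat dart list set" where
  "cell_routes \<nu> i =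
     {R \<in> routes (aug_verts \<nu>) (aug_edges \<nu> (GB_edges \<nu>)).
        ((valley \<nu> i, valley \<nu> (i + 1), Bidir), True) \<notin> set R \<and>
        ((\<exists>e. (e, False) \<in> set R) \<longrightarrow> ((valley \<nu> i, valley \<nu> (i + 1), Bidir), False) \<in> set R)}"

definition cell :: "step list \<Rightarrow> nat \<Rightarrow> (nat edge \<Rightarrow>\<^sub>0 real) set" where
  "cell \<nu> i =
     (if i < num_valleys \<nu>
      then convex hull (char_vec ` cell_routes \<nu> i)
      else {x \<in> coord_space (aug_edges \<nu> (GB_edges \<nu>)).
              \<exists>y \<in> flow_polytope (aug_verts \<nu>) (aug_edges \<nu> (G_edges \<nu>)).
                \<forall>(i, j, d) \<in> aug_edges \<nu> (GB_edges \<nu>).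
                  Poly_Mapping.lookup x (i, j, d) = Poly_Mapping.lookup y (i, j, Fwd)})"

end

theory Submission
  imports Defs
begin

text \<open>
  The graph of \<open>\<nu>\<close> is the path through its valleys with pendant edges attached, so a unit flow of the
  bidirectional graph is determined by its values on the edges at the source and at the sink. Let
  \<open>y k\<close> be the flow from the \<open>k\<close>-th to the \<open>(k + 1)\<close>-st valley, where \<open>y w = 0\<close>. The \<open>i\<close>-th cell
  consists of the flows for which \<open>y i\<close> is the minimum of \<open>y 1, \<dots>, y w\<close>: the cells cover
  because a minimum exists, and their relative interiors are disjoint because \<open>y k - y i\<close> does not
  vanish identically on the \<open>i\<close>-th cell. Subtracting the minimum from all \<open>y k\<close> turns a
  flow in the intersection of the cells indexed by \<open>S\<close> into a nonnegative flow on the oriented cycle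
  through the valleys that vanishes on the edges indexed by \<open>S\<close>, which gives the integral
  equivalence. Integrality of the vertices comes from a coupling of the source flow with the sink flow
  that is monotone in the cyclic order of the valleys cut after \<open>i\<close>.
\<close>

section \<open>Couplings of finite measures\<close>

text \<open>In the values at the source and at the sink the bidirectional polytope is a product of
  two simplices, and its routes correspond to pairs \<open>(i, j)\<close> with \<open>i\<close> in
  \<open>I\<close> and \<open>j\<close> in \<open>J\<close>. The cells are given as hulls of
  selected routes, so the real obstacle is to write a flow with \<open>y c\<close> minimal as a
  combination of routes with the same property; an arbitrary path decomposition does not respect it.
  Conservation makes \<open>y k\<close> a difference of two cumulative sums, so minimality of
  \<open>y c\<close> says exactly that the source flow dominates the sink flow in the cyclic order
  cut after \<open>c\<close>. That is the hypothesis of a monotone coupling, and every pair it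
  couples is a route of the cell. The convention \<open>y w = 0\<close> makes the order cyclic: the
  closing backward edge becomes one more place where the minimum may be attained. Intersections need
  no new decomposition: they are cut out of a single cell by equations \<open>y s = y c\<close>
  whose difference is nonnegative there, so every route of positive weight satisfies them
  too.\<close>

lemma sum_fun_upd_diff:
  fixes p :: "'a \<Rightarrow> real"
  assumes "finite A"
  shows "sum (p(i := p i - m)) A = sum p A - (if i \<in> A then m else 0)"
proof -
  have "sum (p(i := p i - m)) A = (\<Sum>x\<in>A. p x - (if x = i then m else 0))"
    by (rule sum.cong) auto
  then show ?thesis
    using assms by (simp add: sum_subtractf)
qed

text \<open>
  The coupling is built greedily: match as much mass as possible between the \<open>f\<close>-smallest atom of
  \<open>p\<close> and the \<open>g\<close>-smallest atom of \<open>q\<close>, which exhausts one of the two.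
\<close>

lemma monotone_coupling:
  fixes p :: "'a \<Rightarrow> real" and q :: "'b \<Rightarrow> real" and f :: "'a \<Rightarrow> nat" and g :: "'b \<Rightarrow> nat"
  assumes fin: "finite A" "finite B"
    and "\<And>i. i \<in> A \<Longrightarrow> 0 \<le> p i" "\<And>j. j \<in> B \<Longrightarrow> 0 \<le> q j"
    and "sum p A = sum q B"
    and "\<And>k. sum q {j \<in> B. g j \<le> k} \<le> sum p {i \<in> A. f i \<le> k}"
  obtains c where "\<And>i j. i \<in> A \<Longrightarrow> j \<in> B \<Longrightarrow> 0 \<le> c i j"
    and "\<And>i j. i \<in> A \<Longrightarrow> j \<in> B \<Longrightarrow> c i j \<noteq> 0 \<Longrightarrow> f i \<le> g j"
    and "\<And>i. i \<in> A \<Longrightarrow> (\<Sum>j\<in>B. c i j) = p i"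
    and "\<And>j. j \<in> B \<Longrightarrow> (\<Sum>i\<in>A. c i j) = q j"
proof -
  have "\<exists>c. (\<forall>i\<in>A. \<forall>j\<in>B. 0 \<le> c i j \<and> (c i j \<noteq> 0 \<longrightarrow> f i \<le> g j)) \<and>
     (\<forall>i\<in>A. (\<Sum>j\<in>B. c i j) = p i) \<and> (\<forall>j\<in>B. (\<Sum>i\<in>A. c i j) = q j)"
    using assms(3-)
  proof (induction "card {i \<in> A. p i \<noteq> 0} + card {j \<in> B. q j \<noteq> 0}" arbitrary: p q rule: less_induct)
    case (less p q)
    note p0 = less.prems(1) and q0 = less.prems(2) and tot = less.prems(3) and dom = less.prems(4)
    show ?case
    proof (cases "\<forall>i\<in>A. p i = 0")
      case True
      then have "sum q B = 0" using tot by simp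
      then have "\<forall>j\<in>B. q j = 0"
        using q0 fin by (simp add: sum_nonneg_eq_0_iff)
      then show ?thesis using True by (intro exI[of _ "\<lambda>_ _. 0"]) simp
    next
      case False
      then have "sum p A \<noteq> 0"
        using p0 fin by (simp add: sum_nonneg_eq_0_iff)
      then have "\<exists>j\<in>B. q j \<noteq> 0" using tot by (metis sum.neutral)
      then have neB: "{j \<in> B. q j \<noteq> 0} \<noteq> {}" by auto
      have neA: "{i \<in> A. p i \<noteq> 0} \<noteq> {}" using False by auto
      obtain i where i: "i \<in> A" "p i \<noteq> 0" and imin: "\<And>i'. i' \<in> A \<Longrightarrow> p i' \<noteq> 0 \<Longrightarrow> f i \<le> f i'"
        using ex_has_least_nat[of "\<lambda>i. i \<in> A \<and> p i \<noteq> 0" _ f] neA by blast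
      obtain j where j: "j \<in> B" "q j \<noteq> 0" and jmin: "\<And>j'. j' \<in> B \<Longrightarrow> q j' \<noteq> 0 \<Longrightarrow> g j \<le> g j'"
        using ex_has_least_nat[of "\<lambda>j. j \<in> B \<and> q j \<noteq> 0" _ g] neB by blast
      have pi: "p i > 0" and qj: "q j > 0" using i j p0 q0 by (simp_all add: order_less_le)
      \<comment> \<open>Otherwise \<open>p\<close> has no mass at or below level \<open>g j\<close>,
        while \<open>q\<close> has the positive mass \<open>q j\<close> there, against dominance at
        that level.\<close>
      have fg: "f i \<le> g j"
      proof (rule ccontr)
        assume "\<not> f i \<le> g j"
        then have "sum p {i \<in> A. f i \<le> g j} = 0"
          using imin by (intro sum.neutral) fastforce
        moreover have "q j \<le> sum q {j' \<in> B. g j' \<le> g j}"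
          using j q0 fin by (intro member_le_sum) auto
        ultimately show False using dom[of "g j"] qj by simp
      qed
      define m where "m = min (p i) (q j)"
      define p' q' where "p' = p(i := p i - m)" and "q' = q(j := q j - m)"
      have m: "m > 0" "m \<le> p i" "m \<le> q j" using pi qj by (auto simp: m_def)
      have p'0: "0 \<le> p' x" if "x \<in> A" for x using that p0 m by (simp add: p'_def)
      have q'0: "0 \<le> q' x" if "x \<in> B" for x using that q0 m by (simp add: q'_def)
      have tot': "sum p' A = sum q' B"
        unfolding p'_def q'_def sum_fun_upd_diff[OF fin(1)] sum_fun_upd_diff[OF fin(2)]
        using tot i j by simp
      \<comment> \<open>From level \<open>g j\<close> on, which is at least \<open>f i\<close>, both
        cumulative sums lose \<open>m\<close>; below that level \<open>q'\<close> has no mass at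
        all.\<close>
      have dom': "sum q' {j \<in> B. g j \<le> k} \<le> sum p' {i \<in> A. f i \<le> k}" for k
      proof (cases "g j \<le> k")
        case True
        have "finite {j \<in> B. g j \<le> k}" "finite {i \<in> A. f i \<le> k}" using fin by simp_all
        from this[THEN sum_fun_upd_diff] show ?thesis
          unfolding p'_def q'_def using dom[of k] fg i j True by simp
      next
        case False
        then have "q' x = 0" if "x \<in> B" "g x \<le> k" for x
          using that jmin[of x] by (auto simp: q'_def)
        then have "sum q' {j \<in> B. g j \<le> k} = 0" by simp
        then show ?thesis using p'0 by (auto intro: sum_nonneg)
      qed
      have subA: "{x \<in> A. p' x \<noteq> 0} \<subseteq> {x \<in> A. p x \<noteq> 0}" using i by (auto simp: p'_def)
      have subB: "{x \<in> B. q' x \<noteq> 0} \<subseteq> {x \<in> B. q x \<noteq> 0}" using j by (auto simp: q'_def)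
      have "card {x \<in> A. p' x \<noteq> 0} + card {x \<in> B. q' x \<noteq> 0}
          < card {x \<in> A. p x \<noteq> 0} + card {x \<in> B. q x \<noteq> 0}"
      proof (cases "m = p i")
        case True
        then have "{x \<in> A. p' x \<noteq> 0} \<subset> {x \<in> A. p x \<noteq> 0}" using i by (auto simp: p'_def)
        then show ?thesis using subB fin
          by (intro add_less_le_mono psubset_card_mono card_mono) auto
      next
        case False
        then have "m = q j" by (auto simp: m_def)
        then have "{x \<in> B. q' x \<noteq> 0} \<subset> {x \<in> B. q x \<noteq> 0}" using j by (auto simp: q'_def)
        then show ?thesis using subA fin
          by (intro add_le_less_mono psubset_card_mono card_mono) auto
      qed
      from less.hyps[OF this p'0 q'0 tot' dom'] obtain c where
        c: "\<forall>i\<in>A. \<forall>j\<in>B. 0 \<le> c i j \<and> (c i j \<noteq> 0 \<longrightarrow> f i \<le> g j)"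
          "\<forall>i\<in>A. (\<Sum>j\<in>B. c i j) = p' i" "\<forall>j\<in>B. (\<Sum>i\<in>A. c i j) = q' j" by blast
      define d where "d x y = c x y + (if x = i \<and> y = j then m else 0)" for x y
      have "(\<Sum>y\<in>B. d x y) = p x" if "x \<in> A" for x
        using c(2) that i j fin by (cases "x = i") (simp_all add: d_def sum.distrib p'_def)
      moreover have "(\<Sum>x\<in>A. d x y) = q y" if "y \<in> B" for y
        using c(3) that i j fin by (cases "y = j") (simp_all add: d_def sum.distrib q'_def)
      moreover have "\<forall>x\<in>A. \<forall>y\<in>B. 0 \<le> d x y \<and> (d x y \<noteq> 0 \<longrightarrow> f x \<le> g y)"
        using c(1) fg m by (simp add: d_def)
      ultimately show ?thesis by blast
    qed
  qed
  then show ?thesis using that by blast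
qed

section \<open>Finitely supported functions\<close>

lemma lookup_scaleR:
  "Poly_Mapping.lookup (r *\<^sub>R x) e = r *\<^sub>R Poly_Mapping.lookup x e"
  by (simp add: scaleR_poly_mapping_def)

lemma linear_lookup: "linear (\<lambda>x. Poly_Mapping.lookup x e)"
  by (rule linearI) (simp_all add: lookup_add lookup_scaleR)

lemma in_coord_space_iff:
  "x \<in> coord_space K \<longleftrightarrow> (\<forall>e. e \<notin> K \<longrightarrow> Poly_Mapping.lookup x e = 0)"
  by (auto simp: coord_space_def in_keys_iff)

lemma coord_space_zero: "x \<in> coord_space K \<Longrightarrow> e \<notin> K \<Longrightarrow> Poly_Mapping.lookup x e = 0"
  by (simp add: in_coord_space_iff)

definition coord_map :: "'f set \<Rightarrow> (('e \<Rightarrow>\<^sub>0 real) \<Rightarrow> 'f \<Rightarrow> real) \<Rightarrow> ('e \<Rightarrow>\<^sub>0 real) \<Rightarrow> ('f \<Rightarrow>\<^sub>0 real)" where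
  "coord_map K h x = Abs_poly_mapping (\<lambda>e. if e \<in> K then h x e else 0)"

lemma lookup_coord_map:
  "finite K \<Longrightarrow> Poly_Mapping.lookup (coord_map K h x) e = (if e \<in> K then h x e else 0)"
  unfolding coord_map_def by (subst Abs_poly_mapping_inverse) auto

lemma linear_coord_map:
  assumes "finite K" "\<And>e. e \<in> K \<Longrightarrow> linear (\<lambda>x. h x e)"
  shows "linear (coord_map K h)"
  using assms(1) linear_add[OF assms(2)] linear_scale[OF assms(2)]
  by (intro linearI poly_mapping_eqI) (simp_all add: lookup_coord_map lookup_add lookup_scaleR)

lemma coord_map_in_coord_space: "finite K \<Longrightarrow> coord_map K h x \<in> coord_space K"
  by (simp add: in_coord_space_iff lookup_coord_map)

lemma lattice_polytope_linear_image:
  assumes "lattice_polytope P" "linear \<phi>" "\<phi> ` integral_points \<subseteq> integral_points"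
  shows "lattice_polytope (\<phi> ` P)"
proof -
  obtain X where "finite X" "X \<subseteq> integral_points" "P = convex hull X"
    using assms(1) unfolding lattice_polytope_def by blast
  then show ?thesis
    using assms(2,3) unfolding lattice_polytope_def
    by (intro exI[of _ "\<phi> ` X"]) (auto simp: convex_hull_linear_image)
qed

lemma affine_hull_linear_image:
  assumes f: "linear f"
  shows "f ` (affine hull S) = affine hull (f ` S)"
proof
  have "affine {x. f x \<in> affine hull (f ` S)}"
    using f affine_affine_hull[of "f ` S"]
    by (intro affine_def[THEN iffD2]) (simp add: linear_add linear_scale mem_affine)
  then have "affine hull S \<subseteq> {x. f x \<in> affine hull (f ` S)}"
    by (intro hull_minimal) (auto intro: hull_inc)
  then show "f ` (affine hull S) \<subseteq> affine hull (f ` S)" by blast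
  have "affine (f ` (affine hull S))"
  proof (rule affine_def[THEN iffD2], intro ballI allI impI)
    fix x y and u v :: real
    assume "x \<in> f ` (affine hull S)" "y \<in> f ` (affine hull S)" "u + v = 1"
    then obtain x' y' where "x' \<in> affine hull S" "y' \<in> affine hull S" "x = f x'" "y = f y'"
      by blast
    then show "u *\<^sub>R x + v *\<^sub>R y \<in> f ` (affine hull S)"
      using f mem_affine[OF affine_affine_hull _ _ \<open>u + v = 1\<close>, of x' S y']
      by (intro image_eqI[of _ _ "u *\<^sub>R x' + v *\<^sub>R y'"]) (simp_all add: linear_add linear_scale)
  qed
  then show "affine hull (f ` S) \<subseteq> f ` (affine hull S)"
    by (intro hull_minimal image_mono hull_subset)
qed

text \<open>An inverse on \<open>P\<close> alone suffices: the points fixed by \<open>\<psi>\<close>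
  after \<open>\<phi>\<close> form a subspace, so the inversion extends to the affine hull, and
  integrality of both maps then matches the lattice points.\<close>

lemma integrally_equivalentI:
  assumes P: "lattice_polytope P"
    and lin: "linear \<phi>" "linear \<psi>"
    and int: "\<phi> ` integral_points \<subseteq> integral_points" "\<psi> ` integral_points \<subseteq> integral_points"
    and Q: "\<phi> ` P = Q"
    and inv: "\<And>x. x \<in> P \<Longrightarrow> \<psi> (\<phi> x) = x"
  shows "integrally_equivalent P Q"
proof -
  have "lattice_polytope Q"
    using lattice_polytope_linear_image[OF P lin(1) int(1)] Q by simp
  moreover have "affine_map \<phi>"
    unfolding affine_map_def using lin(1) by (intro exI[of _ \<phi>] exI[of _ 0]) auto
  moreover have "bij_betw \<phi> P Q"
    unfolding bij_betw_def using inv Q by (metis inj_on_def)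
  moreover have "bij_betw \<phi> (integral_points \<inter> affine hull P) (integral_points \<inter> affine hull Q)"
  proof -
    have "subspace {x. \<psi> (\<phi> x) = x}"
      using lin by (auto simp: subspace_def linear_0 linear_add linear_scale)
    then have "affine hull P \<subseteq> {x. \<psi> (\<phi> x) = x}"
      using inv by (intro hull_minimal) (auto intro: subspace_imp_affine)
    moreover have "affine hull Q = \<phi> ` (affine hull P)"
      using affine_hull_linear_image[of \<phi> P] lin(1) Q by simp
    ultimately show ?thesis
      using int by (intro bij_betw_byWitness[where f' = \<psi>]) (auto simp: subset_iff)
  qed
  ultimately show ?thesis
    unfolding integrally_equivalent_def using P by blast
qed

text \<open>From a relatively interior point one can move a little further away from
  \<open>z\<close> without leaving \<open>Q\<close>; if \<open>h x\<close> were 0, this move would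
  make \<open>h\<close> negative.\<close>

lemma rel_interior_linear_pos:
  fixes h :: "'a::real_normed_vector \<Rightarrow> real"
  assumes h: "linear h" "\<And>x. x \<in> Q \<Longrightarrow> 0 \<le> h x"
    and z: "z \<in> Q" "0 < h z" and x: "x \<in> rel_interior Q"
  shows "0 < h x"
proof -
  obtain T where T: "open T" "x \<in> T" "T \<inter> affine hull Q \<subseteq> Q" and xQ: "x \<in> Q"
    using x unfolding rel_interior_def openin_open by blast
  have "((\<lambda>t::real. x + t *\<^sub>R (x - z)) \<longlongrightarrow> x + 0 *\<^sub>R (x - z)) (at_right 0)"
    by (intro tendsto_intros)
  then have "\<forall>\<^sub>F t in at_right 0. x + t *\<^sub>R (x - z) \<in> T"
    using T(1,2) by (auto dest: topological_tendstoD)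
  then obtain t :: real where t: "t > 0" "x + t *\<^sub>R (x - z) \<in> T"
    by (metis (mono_tags, lifting) eventually_at_right_less eventually_conj eventually_happens'
        trivial_limit_at_right_real)
  have "(1 + t) *\<^sub>R x + (- t) *\<^sub>R z \<in> affine hull Q"
    using xQ z(1) by (intro mem_affine) (auto intro: hull_inc)
  then have "x + t *\<^sub>R (x - z) \<in> Q"
    using T(3) t(2) by (auto simp: algebra_simps)
  then have "0 \<le> h (x + t *\<^sub>R (x - z))"
    by (rule h(2))
  also have "\<dots> = (1 + t) * h x - t * h z"
    unfolding linear_add[OF h(1)] linear_scale[OF h(1)] linear_diff[OF h(1)]
    by (simp add: algebra_simps)
  finally have "0 < (1 + t) * h x"
    using mult_pos_pos[OF t(1) z(2)] by simp
  then show ?thesis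
    using t(1) by (simp add: zero_less_mult_iff)
qed

section \<open>Routes as unit flows\<close>

text \<open>One sum with incidence coefficients replaces the difference of two sums, so linearity in
  \<open>x\<close> and additivity in \<open>H\<close> reduce to rules for sums.\<close>

lemma netflow_eq_sum:
  assumes "finite H"
  shows "netflow H x j =
    (\<Sum>e\<in>H. (of_bool (lo e = j) - of_bool (hi e = j)) * Poly_Mapping.lookup x e)"
  unfolding netflow_def using assms
  by (simp add: left_diff_distrib sum_subtractf of_bool_def if_distrib[of "\<lambda>t. t * _"]
      sum.inter_filter cong: if_cong)

lemma netflow_add:
  "finite H \<Longrightarrow> netflow H (x + y) j = netflow H x j + netflow H y j"
  by (simp add: netflow_eq_sum lookup_add distrib_left sum.distrib)

lemma netflow_scaleR:
  "finite H \<Longrightarrow> netflow H (r *\<^sub>R x) j = r * netflow H x j"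
  by (simp add: netflow_eq_sum lookup_scaleR sum_distrib_left algebra_simps)

lemma netflow_Un:
  assumes "finite A" "finite B" "A \<inter> B = {}"
  shows "netflow (A \<union> B) x j = netflow A x j + netflow B x j"
  using assms by (simp add: netflow_eq_sum sum.union_disjoint)

locale dart_graph =
  fixes V :: "'v::linorder set" and H :: "'v edge set"
  assumes finite_V: "finite V" and finite_H: "finite H"
    and lo_in_V: "e \<in> H \<Longrightarrow> lo e \<in> V" and hi_in_V: "e \<in> H \<Longrightarrow> hi e \<in> V"
    and Min_neq_Max: "Min V \<noteq> Max V"

sublocale dart_graph \<subseteq> fin_digraph "dart_digraph V H"
proof
  show "finite (arcs (dart_digraph V H))"
    by (rule finite_subset[of _ "H \<times> UNIV"]) (auto simp: dart_digraph_def finite_H)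
qed (use lo_in_V hi_in_V finite_V in \<open>fastforce simp: dart_digraph_def split: if_splits\<close>)+

context dart_graph
begin

abbreviation "D \<equiv> dart_digraph V H"

lemma arcs_D: "d \<in> arcs D \<longleftrightarrow> fst d \<in> H \<and> allowed d"
  by (cases d) (simp add: dart_digraph_def)

lemma tail_D: "tail D d = (if snd d then lo (fst d) else hi (fst d))"
  and head_D: "head D d = (if snd d then hi (fst d) else lo (fst d))"
  by (simp_all add: dart_digraph_def split_beta)

text \<open>A bidirectional edge carries two darts, so distinctness of darts would not prevent both
  from being used. But any dart over the same edge touches the tail of \<open>d\<close>, which a
  path visits only once.\<close>

lemma apath_tail_edge_fresh:
  assumes "apath u (d # R) v"
  shows "fst d \<notin> fst ` set R"
proof
  assume "fst d \<in> fst ` set R"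
  then obtain d' where d': "d' \<in> set R" "fst d' = fst d" by auto
  have R: "awalk (head D d) R v" "tail D d \<notin> set (awalk_verts (head D d) R)"
    using assms apath_Cons_iff awalkI_apath by blast+
  have "tail D d \<in> {tail D d', head D d'}"
    using d'(2) by (auto simp: tail_D head_D)
  then show False
    using R awalk_verts_arc1[OF d'(1)] awalk_verts_arc2[OF R(1) d'(1)] by auto
qed

lemma apath_imp_distinct_edges: "apath u R v \<Longrightarrow> distinct (map fst R)"
proof (induction R arbitrary: u)
  case (Cons d R)
  then show ?case
    using apath_tail_edge_fresh[OF Cons.prems] by (auto simp: apath_Cons_iff)
qed simp

lemma char_vec_Cons:
  assumes "fst d \<notin> fst ` set R"
  shows "char_vec (d # R) = char_vec R + Poly_Mapping.single (fst d) (if snd d then 1 else - 1)"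
proof (rule poly_mapping_eqI)
  fix e
  have "(fst d, b) \<notin> set R" for b using assms by (metis fst_conv image_eqI)
  then show "Poly_Mapping.lookup (char_vec (d # R)) e
      = Poly_Mapping.lookup (char_vec R + Poly_Mapping.single (fst d) (if snd d then 1 else - 1)) e"
    by (cases d) (auto simp: lookup_char_vec lookup_add lookup_single when_def)
qed

text \<open>Prepending a dart moves the unit of supply from its head to its tail, so the
  contributions along the path telescope.\<close>

lemma netflow_char_vec:
  "apath u R v \<Longrightarrow> netflow H (char_vec R) j = of_bool (u = j) - of_bool (v = j)"
proof (induction R arbitrary: u)
  case Nil
  then show ?case by (auto simp: apath_Nil_iff netflow_eq_sum finite_H lookup_char_vec)
next
  case (Cons d R)
  have "netflow H (Poly_Mapping.single (fst d) (if snd d then 1 else - 1)) j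
      = (\<Sum>e\<in>H. if fst d = e then
          (of_bool (lo (fst d) = j) - of_bool (hi (fst d) = j)) * (if snd d then 1 else - 1) else 0)"
    unfolding netflow_eq_sum[OF finite_H]
    by (rule sum.cong) (auto simp: lookup_single)
  also have "\<dots> = of_bool (tail D d = j) - of_bool (head D d = j)"
    using Cons.prems finite_H by (auto simp: apath_Cons_iff arcs_D tail_D head_D)
  finally show ?case
    using Cons.IH[of "head D d"] Cons.prems apath_tail_edge_fresh[OF Cons.prems]
    by (simp add: char_vec_Cons netflow_add finite_H apath_Cons_iff)
qed

lemma routes_eq: "routes V H = {R. apath (Min V) R (Max V)}"
  by (simp add: routes_def)

lemma finite_routes: "finite (routes V H)"
  unfolding routes_eq by (rule apaths_finite)

lemma route_arcs: "R \<in> routes V H \<Longrightarrow> d \<in> set R \<Longrightarrow> fst d \<in> H \<and> allowed d"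
  unfolding routes_eq apath_def awalk_def using arcs_D by blast

lemma route_edge_once:
  assumes "R \<in> routes V H" "(e, b) \<in> set R" "(e, b') \<in> set R"
  shows "b = b'"
  using apath_imp_distinct_edges assms unfolding routes_eq
  by (metis (mono_tags) distinct_map fst_conv inj_onD mem_Collect_eq prod.inject)

lemma lookup_char_vec_route:
  assumes "R \<in> routes V H"
  shows "Poly_Mapping.lookup (char_vec R) e = 1 \<longleftrightarrow> (e, True) \<in> set R"
    and "Poly_Mapping.lookup (char_vec R) e = - 1 \<longleftrightarrow> (e, False) \<in> set R"
  using route_edge_once[OF assms, of e True False] by (auto simp: lookup_char_vec)

lemma char_vec_in_flow_polytope:
  assumes "R \<in> routes V H"
  shows "char_vec R \<in> flow_polytope V H"
proof -
  have "sign_ok (etype e) (Poly_Mapping.lookup (char_vec R) e)" for e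
    using route_arcs[OF assms, of "(e, True)"] route_arcs[OF assms, of "(e, False)"]
    by (auto simp: sign_ok_def lookup_char_vec allowed_def split: edge_type.splits)
  moreover have "char_vec R \<in> coord_space H"
    using route_arcs[OF assms] by (fastforce simp: in_coord_space_iff lookup_char_vec)
  moreover have "netflow H (char_vec R) j = (if j = Min V then 1 else if j = Max V then - 1 else 0)" for j
    using assms netflow_char_vec[of "Min V" R "Max V" j] Min_neq_Max by (auto simp: routes_eq)
  ultimately show ?thesis by (simp add: flow_polytope_def)
qed

lemma char_vec_integral: "char_vec R \<in> integral_points"
  by (simp add: integral_points_def lookup_char_vec)

lemma convex_flow_polytope: "convex (flow_polytope V H)"
proof (rule convexI)
  fix x y :: "'v edge \<Rightarrow>\<^sub>0 real" and u v :: real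
  assume xy: "x \<in> flow_polytope V H" "y \<in> flow_polytope V H" and uv: "0 \<le> u" "0 \<le> v" "u + v = 1"
  have "sign_ok d r \<Longrightarrow> sign_ok d s \<Longrightarrow> sign_ok d (u * r + v * s)" for d r s
    using uv by (auto simp: sign_ok_def mult_nonneg_nonpos add_nonpos_nonpos split: edge_type.splits)
  moreover have "netflow H (u *\<^sub>R x + v *\<^sub>R y) j = u * netflow H x j + v * netflow H y j" for j
    by (simp add: netflow_add netflow_scaleR finite_H)
  ultimately show "u *\<^sub>R x + v *\<^sub>R y \<in> flow_polytope V H"
    using xy uv by (auto simp: flow_polytope_def in_coord_space_iff lookup_add lookup_scaleR
        simp flip: distrib_right)
qed

end

section \<open>Flows on the valley tree\<close>

text \<open>
  The graph of a lattice path with \<open>w\<close> valleys \<open>val 1, \<dots>, val w\<close> is the path through the valleys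
  with a pendant edge from each \<open>i \<in> I - J\<close> to the valley of its block \<open>bI i\<close>, and to each
  \<open>j \<in> J - I\<close> from the valley of its block \<open>bJ j\<close>.
\<close>

locale valley_tree =
  fixes n w :: nat and I J :: "nat set" and val bI bJ :: "nat \<Rightarrow> nat"
  assumes I_Un_J: "I \<union> J = {1..n}" and I_Int_J: "I \<inter> J = val ` {1..w}" and w_pos: "1 \<le> w"
    and bI_range: "i \<in> I \<Longrightarrow> bI i \<in> {1..w}" and bJ_range: "j \<in> J \<Longrightarrow> bJ j \<in> {1..w}"
    and bI_val [simp]: "k \<in> {1..w} \<Longrightarrow> bI (val k) = k"
    and bJ_val [simp]: "k \<in> {1..w} \<Longrightarrow> bJ (val k) = k"
begin

abbreviation "verts_aug \<equiv> {0..Suc n}"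

definition pendant_edges :: "nat edge set" where
  "pendant_edges = (\<lambda>i. (0, i, Fwd)) ` I \<union> (\<lambda>j. (j, Suc n, Fwd)) ` J
     \<union> (\<lambda>i. (i, val (bI i), Fwd)) ` (I - J) \<union> (\<lambda>j. (val (bJ j), j, Fwd)) ` (J - I)"

lemma finite_I [simp]: "finite I" and finite_J [simp]: "finite J"
  using I_Un_J by (metis finite_Un finite_atLeastAtMost)+

lemma I_range: "i \<in> I \<Longrightarrow> 1 \<le> i \<and> i \<le> n" and J_range: "j \<in> J \<Longrightarrow> 1 \<le> j \<and> j \<le> n"
  using I_Un_J by auto

lemma val_in_I: "k \<in> {1..w} \<Longrightarrow> val k \<in> I" and val_in_J: "k \<in> {1..w} \<Longrightarrow> val k \<in> J"
  using I_Int_J by blast+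

lemma ends_notin [simp]: "0 \<notin> I" "0 \<notin> J" "Suc n \<notin> I" "Suc n \<notin> J"
  by (auto dest: I_range J_range)

lemma val_bI: "i \<in> I \<Longrightarrow> val (bI i) \<in> I" "i \<in> I \<Longrightarrow> val (bI i) \<in> J"
  and val_bJ: "j \<in> J \<Longrightarrow> val (bJ j) \<in> I" "j \<in> J \<Longrightarrow> val (bJ j) \<in> J"
  using bI_range bJ_range val_in_I val_in_J by blast+

lemma val_eq_iff: "k \<in> {1..w} \<Longrightarrow> l \<in> {1..w} \<Longrightarrow> val k = val l \<longleftrightarrow> k = l"
  by (metis bI_val)

lemma finite_pendant_edges [simp]: "finite pendant_edges"
  by (simp add: pendant_edges_def)

lemma sum_pendant_edges:
  fixes h :: "nat edge \<Rightarrow> real"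
  shows "sum h pendant_edges = (\<Sum>i\<in>I. h (0, i, Fwd)) + (\<Sum>j\<in>J. h (j, Suc n, Fwd))
    + (\<Sum>i\<in>I - J. h (i, val (bI i), Fwd)) + (\<Sum>j\<in>J - I. h (val (bJ j), j, Fwd))"
proof -
  define A B C E where A: "A = (\<lambda>i. (0::nat, i, Fwd)) ` I" and B: "B = (\<lambda>j. (j, Suc n, Fwd)) ` J"
    and C: "C = (\<lambda>i. (i, val (bI i), Fwd)) ` (I - J)" and E: "E = (\<lambda>j. (val (bJ j), j, Fwd)) ` (J - I)"
  have "val (bJ j) \<noteq> 0" "val (bJ j) \<noteq> Suc n" if "j \<in> J" for j
    using val_bJ[OF that] ends_notin by metis+
  moreover have "val (bI i) \<noteq> 0" "val (bI i) \<noteq> Suc n" if "i \<in> I" for i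
    using val_bI[OF that] ends_notin by metis+
  ultimately have "A \<inter> B = {}" "(A \<union> B) \<inter> C = {}" "(A \<union> B \<union> C) \<inter> E = {}"
    unfolding A B C E using val_bJ by auto
  moreover have "finite A" "finite B" "finite C" "finite E"
    by (simp_all add: A B C E)
  ultimately have "sum h (A \<union> B \<union> C \<union> E) = sum h A + sum h B + sum h C + sum h E"
    by (simp add: sum.union_disjoint)
  then show ?thesis
    unfolding pendant_edges_def A B C E by (simp add: sum.reindex inj_on_def)
qed

text \<open>Each of the four families of edges contributes once through its lower and once through
  its upper endpoints. At the valley ends a sum remains, since several pendant edges may hang at one
  valley.\<close>

lemma netflow_pendant_edges:
  "netflow pendant_edges x u =
     (if u = 0 then \<Sum>i\<in>I. Poly_Mapping.lookup x (0, i, Fwd) else 0)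
     - (if u \<in> I then Poly_Mapping.lookup x (0, u, Fwd) else 0)
     + (if u \<in> J then Poly_Mapping.lookup x (u, Suc n, Fwd) else 0)
     - (if u = Suc n then \<Sum>j\<in>J. Poly_Mapping.lookup x (j, Suc n, Fwd) else 0)
     + (if u \<in> I - J then Poly_Mapping.lookup x (u, val (bI u), Fwd) else 0)
     - (\<Sum>i | i \<in> I - J \<and> val (bI i) = u. Poly_Mapping.lookup x (i, val (bI i), Fwd))
     + (\<Sum>j | j \<in> J - I \<and> val (bJ j) = u. Poly_Mapping.lookup x (val (bJ j), j, Fwd))
     - (if u \<in> J - I then Poly_Mapping.lookup x (val (bJ u), u, Fwd) else 0)"
proof -
  have ind: "(\<Sum>i\<in>A. of_bool (P i) * h i) = (\<Sum>i | i \<in> A \<and> P i. h i)" if "finite A"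
    for A :: "nat set" and P and h :: "nat \<Rightarrow> real"
    using that by (simp add: of_bool_def if_distrib[of "\<lambda>t. t * _"] sum.inter_filter cong: if_cong)
  have one: "{i. i \<in> A \<and> i = u} = (if u \<in> A then {u} else {})" for A :: "nat set" by auto
  have one': "{i. i = u \<and> i \<in> A \<and> i \<notin> B} = (if u \<in> A \<and> u \<notin> B then {u} else {})"
    for A B :: "nat set" by auto
  have const: "(\<Sum>i | i \<in> A \<and> P. h i) = (if P then sum h A else 0)" for A P and h :: "nat \<Rightarrow> real"
    by simp
  show ?thesis
    unfolding netflow_eq_sum[OF finite_pendant_edges] sum_pendant_edges fst_conv snd_conv
      left_diff_distrib sum_subtractf
      ind[OF finite_I] ind[OF finite_J] ind[OF finite_Diff[OF finite_I]] ind[OF finite_Diff[OF finite_J]]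
    by (simp add: one one' const eq_commute[of "Suc n" u])
qed

abbreviation inflow :: "(nat edge \<Rightarrow>\<^sub>0 real) \<Rightarrow> nat \<Rightarrow> real" where
  "inflow x k \<equiv> (\<Sum>i | i \<in> I \<and> bI i = k. Poly_Mapping.lookup x (0, i, Fwd))"

abbreviation outflow :: "(nat edge \<Rightarrow>\<^sub>0 real) \<Rightarrow> nat \<Rightarrow> real" where
  "outflow x k \<equiv> (\<Sum>j | j \<in> J \<and> bJ j = k. Poly_Mapping.lookup x (j, Suc n, Fwd))"

text \<open>What the bidirectional path and the cut cycles have in common; it allows one analysis of
  conservation to serve both kinds of graph.\<close>

definition valley_edges :: "nat edge set \<Rightarrow> bool" where
  "valley_edges M \<longleftrightarrow> finite M \<and> (\<forall>e\<in>M. lo e \<in> val ` {1..w} \<and> hi e \<in> val ` {1..w})"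

lemma valley_edges_disjoint:
  assumes "valley_edges M"
  shows "pendant_edges \<inter> M = {}"
proof -
  have "lo e \<in> I \<inter> J \<and> hi e \<in> I \<inter> J" if "e \<in> M" for e
    using that assms I_Int_J by (auto simp: valley_edges_def)
  then show ?thesis
    unfolding pendant_edges_def by (fastforce dest: I_range J_range)
qed

lemma netflow_outside_valleys:
  assumes "valley_edges M" "u \<notin> I \<inter> J"
  shows "netflow M x u = 0"
proof -
  have no: "{e \<in> M. lo e = u} = {}" "{e \<in> M. hi e = u} = {}"
    using assms I_Int_J by (auto simp: valley_edges_def)
  show ?thesis unfolding netflow_def no by simp
qed

lemma Min_Max_verts_aug [simp]: "Min verts_aug = 0" "Max verts_aug = Suc n"
  by (auto intro: Min_eqI Max_eqI)

text \<open>Conservation at a pendant vertex copies its value at the source or the sink onto its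
  pendant edge. After this substitution, conservation at a valley involves only the totals of its
  block, and all dependence on the graph sits in \<open>M\<close>.\<close>

lemma flow_polytope_iff:
  assumes M: "valley_edges M"
  shows "x \<in> flow_polytope verts_aug (pendant_edges \<union> M) \<longleftrightarrow>
    x \<in> coord_space (pendant_edges \<union> M)
    \<and> (\<forall>e\<in>pendant_edges. 0 \<le> Poly_Mapping.lookup x e)
    \<and> (\<forall>e\<in>M. sign_ok (etype e) (Poly_Mapping.lookup x e))
    \<and> (\<Sum>i\<in>I. Poly_Mapping.lookup x (0, i, Fwd)) = 1
    \<and> (\<Sum>j\<in>J. Poly_Mapping.lookup x (j, Suc n, Fwd)) = 1
    \<and> (\<forall>i\<in>I - J. Poly_Mapping.lookup x (i, val (bI i), Fwd) = Poly_Mapping.lookup x (0, i, Fwd))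
    \<and> (\<forall>j\<in>J - I. Poly_Mapping.lookup x (val (bJ j), j, Fwd) = Poly_Mapping.lookup x (j, Suc n, Fwd))
    \<and> (\<forall>k\<in>{1..w}. netflow M x (val k) = inflow x k - outflow x k)"
proof -
  let ?c = "Poly_Mapping.lookup x"
  let ?nf = "netflow (pendant_edges \<union> M) x"
  let ?tree = "(\<forall>i\<in>I - J. ?c (i, val (bI i), Fwd) = ?c (0, i, Fwd))
    \<and> (\<forall>j\<in>J - I. ?c (val (bJ j), j, Fwd) = ?c (j, Suc n, Fwd))"
  have nf: "?nf u = netflow pendant_edges x u + netflow M x u" for u
    using M valley_edges_disjoint[OF M] by (intro netflow_Un) (auto simp: valley_edges_def)
  have noI: "{i. i \<in> I - J \<and> val (bI i) = u} = {}" and noJ: "{i. i \<in> J - I \<and> val (bJ i) = u} = {}"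
    if "u \<notin> I \<inter> J" for u
    using that val_bI val_bJ by auto
  have nf_off: "?nf u = (if u = 0 then \<Sum>i\<in>I. ?c (0, i, Fwd) else 0)
      - (if u \<in> I then ?c (0, u, Fwd) else 0) + (if u \<in> J then ?c (u, Suc n, Fwd) else 0)
      - (if u = Suc n then \<Sum>j\<in>J. ?c (j, Suc n, Fwd) else 0)
      + (if u \<in> I - J then ?c (u, val (bI u), Fwd) else 0)
      - (if u \<in> J - I then ?c (val (bJ u), u, Fwd) else 0)" if "u \<notin> I \<inter> J" for u
    unfolding nf netflow_pendant_edges netflow_outside_valleys[OF M that] noI[OF that] noJ[OF that]
    by simp
  have nf0: "?nf 0 = (\<Sum>i\<in>I. ?c (0, i, Fwd))"
    by (subst nf_off) simp_all
  have nft: "?nf (Suc n) = - (\<Sum>j\<in>J. ?c (j, Suc n, Fwd))"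
    by (subst nf_off) simp_all
  have nfI: "?nf i = ?c (i, val (bI i), Fwd) - ?c (0, i, Fwd)" if "i \<in> I - J" for i
    using that by (subst nf_off) auto
  have nfJ: "?nf j = ?c (j, Suc n, Fwd) - ?c (val (bJ j), j, Fwd)" if "j \<in> J - I" for j
    using that by (subst nf_off) auto
  have nfV: "?nf (val k) = outflow x k - inflow x k + netflow M x (val k)"
    if k: "k \<in> {1..w}" and tree: ?tree for k
  proof -
    have vk: "val k \<in> I" "val k \<in> J" "val k \<noteq> 0" "val k \<noteq> Suc n"
      using val_in_I[OF k] val_in_J[OF k] ends_notin by metis+
    \<comment> \<open>An element of \<open>I\<close> that also lies in \<open>J\<close> is a valley,
      so the block consists of its own valley and of the pendant vertices hanging there.\<close>
    have sI: "{i \<in> I. bI i = k} = insert (val k) {i. i \<in> I - J \<and> val (bI i) = val k}"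
    proof (intro equalityI subsetI)
      fix i assume i: "i \<in> {i \<in> I. bI i = k}"
      show "i \<in> insert (val k) {i. i \<in> I - J \<and> val (bI i) = val k}"
      proof (cases "i \<in> J")
        case True
        then obtain l where "l \<in> {1..w}" "i = val l" using i I_Int_J by blast
        then show ?thesis using i by simp
      qed (use i in auto)
    next
      fix i assume "i \<in> insert (val k) {i. i \<in> I - J \<and> val (bI i) = val k}"
      then show "i \<in> {i \<in> I. bI i = k}"
        using k vk bI_range val_eq_iff[OF _ k] by auto
    qed
    have sJ: "{i \<in> J. bJ i = k} = insert (val k) {i. i \<in> J - I \<and> val (bJ i) = val k}"
    proof (intro equalityI subsetI)
      fix i assume i: "i \<in> {i \<in> J. bJ i = k}"
      show "i \<in> insert (val k) {i. i \<in> J - I \<and> val (bJ i) = val k}"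
      proof (cases "i \<in> I")
        case True
        then obtain l where "l \<in> {1..w}" "i = val l" using i I_Int_J by blast
        then show ?thesis using i by simp
      qed (use i in auto)
    next
      fix i assume "i \<in> insert (val k) {i. i \<in> J - I \<and> val (bJ i) = val k}"
      then show "i \<in> {i \<in> J. bJ i = k}"
        using k vk bJ_range val_eq_iff[OF _ k] by auto
    qed
    have rI: "(\<Sum>i | i \<in> I - J \<and> val (bI i) = val k. ?c (i, val (bI i), Fwd))
        = (\<Sum>i | i \<in> I - J \<and> val (bI i) = val k. ?c (0, i, Fwd))"
      by (rule sum.cong[OF refl]) (use tree in blast)
    have rJ: "(\<Sum>j | j \<in> J - I \<and> val (bJ j) = val k. ?c (val (bJ j), j, Fwd))
        = (\<Sum>j | j \<in> J - I \<and> val (bJ j) = val k. ?c (j, Suc n, Fwd))"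
      by (rule sum.cong[OF refl]) (use tree in blast)
    have "inflow x k = ?c (0, val k, Fwd) + (\<Sum>i | i \<in> I - J \<and> val (bI i) = val k. ?c (i, val (bI i), Fwd))"
      unfolding sI rI using vk by (subst sum.insert) auto
    moreover have "outflow x k = ?c (val k, Suc n, Fwd)
        + (\<Sum>j | j \<in> J - I \<and> val (bJ j) = val k. ?c (val (bJ j), j, Fwd))"
      unfolding sJ rJ using vk by (subst sum.insert) auto
    ultimately show ?thesis
      unfolding nf netflow_pendant_edges using vk by simp
  qed
  have "{0..Suc n} = insert 0 (insert (Suc n) ((I - J) \<union> (J - I) \<union> val ` {1..w}))"
  proof -
    have "{0..Suc n} = insert 0 (insert (Suc n) {1..n})" by auto
    also have "{1..n} = (I - J) \<union> (J - I) \<union> val ` {1..w}"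
      unfolding I_Un_J[symmetric] I_Int_J[symmetric] by auto
    finally show ?thesis .
  qed
  moreover have "val k \<noteq> 0 \<and> val k \<noteq> Suc n" if "k \<in> {1..w}" for k
    using val_in_I[OF that] ends_notin by metis
  ultimately have "(\<forall>j\<in>{0..Suc n}. ?nf j = (if j = 0 then 1 else if j = Suc n then - 1 else 0))
    \<longleftrightarrow> ?nf 0 = 1 \<and> ?nf (Suc n) = - 1 \<and> (\<forall>j\<in>I - J. ?nf j = 0) \<and> (\<forall>j\<in>J - I. ?nf j = 0)
      \<and> (\<forall>k\<in>{1..w}. ?nf (val k) = 0)"
    by (auto simp: ball_Un)
  moreover have "(\<forall>j\<in>I - J. ?nf j = 0) \<and> (\<forall>j\<in>J - I. ?nf j = 0) \<longleftrightarrow> ?tree"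
    using nfI nfJ by auto
  moreover have "(\<forall>k\<in>{1..w}. ?nf (val k) = 0)
      \<longleftrightarrow> (\<forall>k\<in>{1..w}. netflow M x (val k) = inflow x k - outflow x k)" if tree: ?tree
  proof (rule ball_cong[OF refl])
    fix k assume "k \<in> {1..w}"
    from nfV[OF this tree] show "?nf (val k) = 0 \<longleftrightarrow> netflow M x (val k) = inflow x k - outflow x k"
      by linarith
  qed
  moreover have "(\<forall>e\<in>pendant_edges. sign_ok (etype e) (?c e)) \<longleftrightarrow> (\<forall>e\<in>pendant_edges. 0 \<le> ?c e)"
    by (intro ball_cong) (auto simp: pendant_edges_def sign_ok_def)
  ultimately show ?thesis
    unfolding flow_polytope_def Min_Max_verts_aug mem_Collect_eq ball_Un nf0 nft by argo
qed

section \<open>Cutting the cycle of valleys\<close>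

definition valley_path :: "edge_type \<Rightarrow> nat edge set" where
  "valley_path d = (\<lambda>k. (val k, val (Suc k), d)) ` {1..<w}"

text \<open>
  The edges \<open>cycle_edge 1, \<dots>, cycle_edge w\<close> form an oriented cycle: the last one, being backward,
  leads from \<open>val w\<close> to \<open>val 1\<close>.
\<close>

definition cycle_edge :: "nat \<Rightarrow> nat edge" where
  "cycle_edge k = (if k < w then (val k, val (Suc k), Fwd) else (val 1, val w, Bwd))"

definition cut_cycle :: "nat set \<Rightarrow> nat edge set" where
  "cut_cycle S = cycle_edge ` ({1..w} - S)"

lemma valley_edges_valley_path: "valley_edges (valley_path d)"
  by (auto simp: valley_edges_def valley_path_def)

lemma valley_edges_cut_cycle: "valley_edges (cut_cycle S)"
  using w_pos by (auto simp: valley_edges_def cut_cycle_def cycle_edge_def)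

text \<open>For \<open>w = 2\<close> the two edges of the cycle are parallel and only their types
  tell them apart.\<close>

lemma cycle_edge_eq_iff: "k \<in> {1..w} \<Longrightarrow> l \<in> {1..w} \<Longrightarrow> cycle_edge k = cycle_edge l \<longleftrightarrow> k = l"
  using val_eq_iff by (auto simp: cycle_edge_def)

lemma cycle_edge_in_iff:
  assumes "k \<in> {1..w}"
  shows "cycle_edge k \<in> pendant_edges \<union> cut_cycle S \<longleftrightarrow> k \<notin> S"
proof -
  have "cycle_edge k \<notin> pendant_edges"
    using valley_edges_disjoint[OF valley_edges_cut_cycle[of "{}"]] assms
    by (auto simp: cut_cycle_def)
  then show ?thesis using assms cycle_edge_eq_iff by (auto simp: cut_cycle_def)
qed

text \<open>
  With the convention that the flow vanishes for \<open>k = 0\<close> and \<open>k = w\<close>, conservation takes the same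
  form at all valleys.
\<close>

definition vflow :: "(nat edge \<Rightarrow>\<^sub>0 real) \<Rightarrow> nat \<Rightarrow> real" where
  "vflow x k = (if 1 \<le> k \<and> k < w then Poly_Mapping.lookup x (val k, val (Suc k), Bidir) else 0)"

text \<open>The sign turns the value on the backward edge, which is nonpositive in a flow, into flow
  along the orientation of the cycle. Indices 0 and \<open>w\<close> give the same value because the
  cycle closes up.\<close>

definition cflow :: "(nat edge \<Rightarrow>\<^sub>0 real) \<Rightarrow> nat \<Rightarrow> real" where
  "cflow x k = (if 1 \<le> k \<and> k < w then Poly_Mapping.lookup x (cycle_edge k)
     else - Poly_Mapping.lookup x (cycle_edge w))"

lemma netflow_valley_path:
  assumes "k \<in> {1..w}"
  shows "netflow (valley_path d) x (val k) =
    (if k < w then Poly_Mapping.lookup x (val k, val (Suc k), d) else 0)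
    - (if 1 < k then Poly_Mapping.lookup x (val (k - 1), val k, d) else 0)"
proof -
  have "{e \<in> valley_path d. lo e = val k} = (if k < w then {(val k, val (Suc k), d)} else {})"
    using assms by (auto simp: valley_path_def val_eq_iff)
  moreover have "{e \<in> valley_path d. hi e = val k} = (if 1 < k then {(val (k - 1), val k, d)} else {})"
  proof -
    have "{e \<in> valley_path d. hi e = val k} = (\<lambda>l. (val l, val (Suc l), d)) ` {l \<in> {1..<w}. Suc l = k}"
      using assms by (auto simp: valley_path_def val_eq_iff)
    also have "{l \<in> {1..<w}. Suc l = k} = (if 1 < k then {k - 1} else {})"
      using assms by auto
    finally show ?thesis by auto
  qed
  ultimately show ?thesis by (simp only: netflow_def) simp
qed

lemma netflow_valley_path_Bidir:
  "k \<in> {1..w} \<Longrightarrow> netflow (valley_path Bidir) x (val k) = vflow x k - vflow x (k - 1)"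
  by (auto simp: netflow_valley_path vflow_def)

text \<open>The coordinates of cut edges vanish, so the sum may run over the whole cycle, which is
  the forward path together with one backward edge.\<close>

lemma netflow_cut_cycle:
  assumes k: "k \<in> {1..w}" and x: "x \<in> coord_space (pendant_edges \<union> cut_cycle S)"
  shows "netflow (cut_cycle S) x (val k) = cflow x k - cflow x (k - 1)"
proof -
  have fin: "finite (cut_cycle T)" for T by (simp add: cut_cycle_def)
  have sub: "cut_cycle S \<subseteq> cut_cycle {}" by (auto simp: cut_cycle_def)
  have zero: "Poly_Mapping.lookup x e = 0" if "e \<in> cut_cycle {} - cut_cycle S" for e
    using that valley_edges_disjoint[OF valley_edges_cut_cycle[of "{}"]]
    by (intro coord_space_zero[OF x]) blast
  have "netflow (cut_cycle S) x (val k) = netflow (cut_cycle {}) x (val k)"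
    unfolding netflow_eq_sum[OF fin] using fin sub zero by (intro sum.mono_neutral_left) auto
  also have "cut_cycle {} = valley_path Fwd \<union> {(val 1, val w, Bwd)}"
  proof -
    have "{1..w} = insert w {1..<w}" using w_pos by auto
    then show ?thesis by (auto simp: cut_cycle_def valley_path_def cycle_edge_def)
  qed
  also have "netflow \<dots> x (val k) = netflow (valley_path Fwd) x (val k)
      + netflow {(val 1, val w, Bwd)} x (val k)"
    by (rule netflow_Un) (auto simp: valley_path_def)
  \<comment> \<open>For \<open>w = 1\<close> the backward edge is a loop at \<open>val 1\<close>;
    its two contributions cancel, in agreement with \<open>cflow x 1 = cflow x 0\<close>.\<close>
  also have "\<dots> = cflow x k - cflow x (k - 1)"
    using k w_pos unfolding netflow_valley_path[OF k] cflow_def cycle_edge_def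
    by (auto simp: netflow_eq_sum val_eq_iff)
  finally show ?thesis .
qed

section \<open>Inequality descriptions of the flow polytopes\<close>

abbreviation "bidir_polytope \<equiv> flow_polytope verts_aug (pendant_edges \<union> valley_path Bidir)"

abbreviation "cut_polytope S \<equiv> flow_polytope verts_aug (pendant_edges \<union> cut_cycle S)"

text \<open>The part of the flow conditions that is the same for all graphs considered and depends
  on pendant coordinates only.\<close>

definition unit_pendant_flow :: "(nat edge \<Rightarrow>\<^sub>0 real) \<Rightarrow> bool" where
  "unit_pendant_flow x \<longleftrightarrow>
    (\<forall>e\<in>pendant_edges. 0 \<le> Poly_Mapping.lookup x e)
    \<and> (\<Sum>i\<in>I. Poly_Mapping.lookup x (0, i, Fwd)) = 1
    \<and> (\<Sum>j\<in>J. Poly_Mapping.lookup x (j, Suc n, Fwd)) = 1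
    \<and> (\<forall>i\<in>I - J. Poly_Mapping.lookup x (i, val (bI i), Fwd) = Poly_Mapping.lookup x (0, i, Fwd))
    \<and> (\<forall>j\<in>J - I. Poly_Mapping.lookup x (val (bJ j), j, Fwd) = Poly_Mapping.lookup x (j, Suc n, Fwd))"

lemma pendant_edgesI:
  "i \<in> I \<Longrightarrow> (0, i, Fwd) \<in> pendant_edges" "j \<in> J \<Longrightarrow> (j, Suc n, Fwd) \<in> pendant_edges"
  "i \<in> I - J \<Longrightarrow> (i, val (bI i), Fwd) \<in> pendant_edges"
  "j \<in> J - I \<Longrightarrow> (val (bJ j), j, Fwd) \<in> pendant_edges"
  by (auto simp: pendant_edges_def)

lemma pendant_flow_cong:
  assumes "\<And>e. e \<in> pendant_edges \<Longrightarrow> Poly_Mapping.lookup x e = Poly_Mapping.lookup y e"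
  shows "unit_pendant_flow x \<longleftrightarrow> unit_pendant_flow y" "inflow x k = inflow y k" "outflow x k = outflow y k"
proof -
  note eq = assms[OF pendant_edgesI(1)] assms[OF pendant_edgesI(2)]
    assms[OF pendant_edgesI(3)] assms[OF pendant_edgesI(4)]
  show "unit_pendant_flow x \<longleftrightarrow> unit_pendant_flow y"
    unfolding unit_pendant_flow_def using assms eq by simp
  show "inflow x k = inflow y k" "outflow x k = outflow y k"
    using eq by (auto intro: sum.cong)
qed

lemma bidir_polytope_iff:
  "x \<in> bidir_polytope \<longleftrightarrow> x \<in> coord_space (pendant_edges \<union> valley_path Bidir) \<and> unit_pendant_flow x
    \<and> (\<forall>k\<in>{1..w}. vflow x k - vflow x (k - 1) = inflow x k - outflow x k)"
proof -
  have "\<forall>e\<in>valley_path Bidir. sign_ok (etype e) r" for r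
    by (auto simp: valley_path_def sign_ok_def)
  then show ?thesis
    unfolding flow_polytope_iff[OF valley_edges_valley_path] unit_pendant_flow_def
    using netflow_valley_path_Bidir by (auto simp: valley_path_def sign_ok_def)
qed

lemma cflow_cut:
  assumes x: "x \<in> coord_space (pendant_edges \<union> cut_cycle S)" and S: "S \<subseteq> {1..w}" "k \<in> S"
  shows "cflow x k = 0"
proof -
  have "k \<in> {1..w}" using S by blast
  then have "Poly_Mapping.lookup x (cycle_edge k) = 0"
    using S cycle_edge_in_iff by (intro coord_space_zero[OF x]) blast
  then show ?thesis
    using \<open>k \<in> {1..w}\<close> by (cases "k = w") (auto simp: cflow_def)
qed

text \<open>In terms of \<open>cflow\<close> the sign conditions of forward and backward edges
  coincide, and they hold trivially at cut edges, where \<open>cflow\<close> is 0. Hence the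
  quantifier can run over the whole cycle.\<close>

lemma cut_polytope_iff:
  assumes "S \<subseteq> {1..w}"
  shows "x \<in> cut_polytope S \<longleftrightarrow> x \<in> coord_space (pendant_edges \<union> cut_cycle S) \<and> unit_pendant_flow x
    \<and> (\<forall>k\<in>{1..w}. 0 \<le> cflow x k)
    \<and> (\<forall>k\<in>{1..w}. cflow x k - cflow x (k - 1) = inflow x k - outflow x k)"
proof -
  have "(\<forall>e\<in>cut_cycle S. sign_ok (etype e) (Poly_Mapping.lookup x e)) \<longleftrightarrow> (\<forall>k\<in>{1..w}. 0 \<le> cflow x k)"
    if x: "x \<in> coord_space (pendant_edges \<union> cut_cycle S)"
  proof -
    have "sign_ok (etype (cycle_edge k)) (Poly_Mapping.lookup x (cycle_edge k)) \<longleftrightarrow> 0 \<le> cflow x k"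
      if "k \<in> {1..w}" for k
      using that by (auto simp: cycle_edge_def cflow_def sign_ok_def not_less)
    moreover have "cflow x k = 0" if "k \<in> S" for k
      using cflow_cut[OF x assms that] .
    ultimately have "(\<forall>k\<in>{1..w} - S. sign_ok (etype (cycle_edge k)) (Poly_Mapping.lookup x (cycle_edge k)))
      \<longleftrightarrow> (\<forall>k\<in>{1..w}. 0 \<le> cflow x k)"
      by (metis Diff_iff order_refl)
    then show ?thesis by (simp add: cut_cycle_def)
  qed
  then show ?thesis
    unfolding flow_polytope_iff[OF valley_edges_cut_cycle] unit_pendant_flow_def
    using netflow_cut_cycle by auto
qed

text \<open>Since \<open>vflow x w = 0\<close> takes part in the comparison, the minimum is never
  positive; for \<open>w\<close> in \<open>S\<close> the condition says that all valley flows are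
  nonnegative.\<close>

definition min_cell :: "nat set \<Rightarrow> (nat edge \<Rightarrow>\<^sub>0 real) set" where
  "min_cell S = {x \<in> bidir_polytope. \<forall>i\<in>S. \<forall>k\<in>{1..w}. vflow x i \<le> vflow x k}"

text \<open>On the cell, \<open>vflow x i\<close> for a fixed \<open>i\<close> in \<open>S\<close>
  is the minimum to be subtracted; naming \<open>i\<close> instead of taking the minimum keeps the
  map linear. The backward edge receives the minimum itself, and \<open>bI (lo e)\<close> recovers
  \<open>k\<close> from the edge leaving \<open>val k\<close> forward.\<close>

definition to_cut :: "nat \<Rightarrow> nat set \<Rightarrow> (nat edge \<Rightarrow>\<^sub>0 real) \<Rightarrow> (nat edge \<Rightarrow>\<^sub>0 real)" where
  "to_cut i S = coord_map (pendant_edges \<union> cut_cycle S)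
     (\<lambda>x e. if e \<in> pendant_edges then Poly_Mapping.lookup x e
        else if etype e = Bwd then vflow x i else vflow x (bI (lo e)) - vflow x i)"

text \<open>The value \<open>cflow x w\<close> is minus the value on the backward edge, that is,
  minus the minimum stored there by \<open>to_cut\<close>; subtracting it undoes the shift. On a
  flow of the cut polytope a cut forward edge is read as 0.\<close>

definition from_cut :: "(nat edge \<Rightarrow>\<^sub>0 real) \<Rightarrow> (nat edge \<Rightarrow>\<^sub>0 real)" where
  "from_cut = coord_map (pendant_edges \<union> valley_path Bidir)
     (\<lambda>x e. if e \<in> pendant_edges then Poly_Mapping.lookup x e
        else Poly_Mapping.lookup x (lo e, hi e, Fwd) - cflow x w)"

section \<open>Linearity, integrality and inversion of the two shifts\<close>

lemma finite_cut_cycle [simp]: "finite (cut_cycle S)"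
  and finite_valley_path [simp]: "finite (valley_path d)"
  by (simp_all add: cut_cycle_def valley_path_def)

lemma valley_path_not_pendant:
  assumes "1 \<le> k" "k < w"
  shows "(val k, val (Suc k), d) \<notin> pendant_edges"
  using assms valley_edges_disjoint[OF valley_edges_valley_path[of d]]
  by (auto simp: valley_path_def)

lemma linear_vflow: "linear (\<lambda>x. vflow x k)"
  by (cases "1 \<le> k \<and> k < w") (auto simp: vflow_def linear_lookup linear_zero)

lemma linear_cflow: "linear (\<lambda>x. cflow x k)"
  unfolding cflow_def by (cases "1 \<le> k \<and> k < w") (auto simp: linear_lookup linear_compose_neg)

lemma linear_to_cut: "linear (to_cut i S)"
  unfolding to_cut_def
proof (rule linear_coord_map)
  fix e
  show "linear (\<lambda>x. if e \<in> pendant_edges then Poly_Mapping.lookup x e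
      else if etype e = Bwd then vflow x i else vflow x (bI (lo e)) - vflow x i)"
    by (cases "e \<in> pendant_edges"; cases "etype e = Bwd")
      (simp_all add: linear_lookup linear_vflow linear_compose_sub)
qed simp

lemma linear_from_cut: "linear from_cut"
  unfolding from_cut_def
proof (rule linear_coord_map)
  fix e
  show "linear (\<lambda>x. if e \<in> pendant_edges then Poly_Mapping.lookup x e
      else Poly_Mapping.lookup x (lo e, hi e, Fwd) - cflow x w)"
    by (cases "e \<in> pendant_edges") (simp_all add: linear_lookup linear_cflow linear_compose_sub)
qed simp

lemma integral_flows:
  assumes "x \<in> integral_points"
  shows "vflow x k \<in> \<int>" "cflow x k \<in> \<int>"
proof -
  have "Poly_Mapping.lookup x e \<in> \<int>" for e
    using assms unfolding integral_points_def by blast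
  then show "vflow x k \<in> \<int>" "cflow x k \<in> \<int>"
    by (simp_all add: vflow_def cflow_def)
qed

lemma to_cut_integral: "to_cut i S ` integral_points \<subseteq> integral_points"
proof clarify
  fix x :: "nat edge \<Rightarrow>\<^sub>0 real" assume x: "x \<in> integral_points"
  then have "Poly_Mapping.lookup x e \<in> \<int>" for e unfolding integral_points_def by blast
  then have "Poly_Mapping.lookup (to_cut i S x) e \<in> \<int>" for e
    using integral_flows[OF x] by (simp add: to_cut_def lookup_coord_map)
  then show "to_cut i S x \<in> integral_points" by (simp add: integral_points_def)
qed

lemma from_cut_integral: "from_cut ` integral_points \<subseteq> integral_points"
proof clarify
  fix x :: "nat edge \<Rightarrow>\<^sub>0 real" assume x: "x \<in> integral_points"
  then have "Poly_Mapping.lookup x e \<in> \<int>" for e unfolding integral_points_def by blast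
  then have "Poly_Mapping.lookup (from_cut x) e \<in> \<int>" for e
    using integral_flows[OF x] by (simp add: from_cut_def lookup_coord_map)
  then show "from_cut x \<in> integral_points" by (simp add: integral_points_def)
qed

lemma to_cut_in_coord_space: "to_cut i S x \<in> coord_space (pendant_edges \<union> cut_cycle S)"
  and from_cut_in_coord_space: "from_cut x \<in> coord_space (pendant_edges \<union> valley_path Bidir)"
  by (simp_all add: to_cut_def from_cut_def coord_map_in_coord_space)

lemma lookup_to_cut_pendant:
  "e \<in> pendant_edges \<Longrightarrow> Poly_Mapping.lookup (to_cut i S x) e = Poly_Mapping.lookup x e"
  by (simp add: to_cut_def lookup_coord_map)

lemma lookup_from_cut_pendant:
  "e \<in> pendant_edges \<Longrightarrow> Poly_Mapping.lookup (from_cut x) e = Poly_Mapping.lookup x e"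
  by (simp add: from_cut_def lookup_coord_map)

lemma lookup_to_cut_cycle_edge:
  assumes "k \<in> {1..w}"
  shows "Poly_Mapping.lookup (to_cut i S x) (cycle_edge k) =
    (if k \<in> S then 0 else if k < w then vflow x k - vflow x i else vflow x i)"
proof -
  have "cycle_edge k \<notin> pendant_edges"
    using cycle_edge_in_iff[OF assms, of "{k}"] by simp
  moreover have "cycle_edge k \<in> cut_cycle S \<longleftrightarrow> k \<notin> S"
    using cycle_edge_in_iff[OF assms, of S] calculation by simp
  ultimately show ?thesis
    using assms by (simp add: to_cut_def lookup_coord_map) (auto simp: cycle_edge_def)
qed

lemma min_cell_vflow_eq:
  assumes "x \<in> min_cell S" "S \<subseteq> {1..w}" "i \<in> S" "k \<in> S"
  shows "vflow x i = vflow x k"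
  using assms by (intro antisym) (auto simp: min_cell_def)

lemma vflow_0 [simp]: "vflow x 0 = 0" and vflow_w [simp]: "vflow x w = 0"
  by (simp_all add: vflow_def)

text \<open>The coordinates suppressed by the cut agree with the formula because
  \<open>vflow\<close> has the same value on all of \<open>S\<close>. In particular, if
  \<open>w\<close> is in \<open>S\<close>, the missing backward edge is consistent with a minimum of
  0.\<close>

lemma cflow_to_cut:
  assumes x: "x \<in> min_cell S" and S: "S \<subseteq> {1..w}" "i \<in> S" and k: "k \<le> w"
  shows "cflow (to_cut i S x) k = vflow x k - vflow x i"
proof (cases "1 \<le> k \<and> k < w")
  case True
  then show ?thesis
    using min_cell_vflow_eq[OF x S(1), of k i] S(2) by (simp add: cflow_def lookup_to_cut_cycle_edge)
next
  case False
  then have "vflow x k = 0" by (auto simp: vflow_def)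
  then show ?thesis
    using False min_cell_vflow_eq[OF x S(1), of w i] S(2) w_pos
    by (auto simp: cflow_def lookup_to_cut_cycle_edge)
qed

lemma cflow_0 [simp]: "cflow x 0 = cflow x w"
  by (simp add: cflow_def)

lemma vflow_from_cut:
  assumes "k \<le> w"
  shows "vflow (from_cut x) k = cflow x k - cflow x w"
proof (cases "1 \<le> k \<and> k < w")
  case True
  then have "(val k, val (Suc k), Bidir) \<in> valley_path Bidir" by (auto simp: valley_path_def)
  then show ?thesis
    using True valley_path_not_pendant[of k Bidir]
    by (simp add: vflow_def from_cut_def lookup_coord_map) (simp add: cflow_def cycle_edge_def)
next
  case False
  then have "k = 0 \<or> k = w" using assms by auto
  then show ?thesis by auto
qed

lemma to_cut_in_cut_polytope:
  assumes x: "x \<in> min_cell S" and S: "S \<subseteq> {1..w}" "i \<in> S"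
  shows "to_cut i S x \<in> cut_polytope S"
proof -
  have cong: "unit_pendant_flow (to_cut i S x) \<longleftrightarrow> unit_pendant_flow x"
    "inflow (to_cut i S x) k = inflow x k" "outflow (to_cut i S x) k = outflow x k" for k
    by (rule pendant_flow_cong, erule lookup_to_cut_pendant)+
  have "x \<in> bidir_polytope" "\<And>k. k \<in> {1..w} \<Longrightarrow> vflow x i \<le> vflow x k"
    using x S by (auto simp: min_cell_def)
  then show ?thesis
    unfolding cut_polytope_iff[OF S(1)] bidir_polytope_iff cong
    using cflow_to_cut[OF assms] to_cut_in_coord_space by auto
qed

text \<open>All valley flows are shifted by the same amount, so their order is that of
  \<open>cflow\<close>, which is nonnegative and vanishes on \<open>S\<close>.\<close>

lemma from_cut_in_min_cell:
  assumes z: "z \<in> cut_polytope S" and S: "S \<subseteq> {1..w}"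
  shows "from_cut z \<in> min_cell S"
proof -
  have cong: "unit_pendant_flow (from_cut z) \<longleftrightarrow> unit_pendant_flow z"
    "inflow (from_cut z) k = inflow z k" "outflow (from_cut z) k = outflow z k" for k
    by (rule pendant_flow_cong, erule lookup_from_cut_pendant)+
  have *: "z \<in> coord_space (pendant_edges \<union> cut_cycle S)" "\<And>k. k \<in> {1..w} \<Longrightarrow> 0 \<le> cflow z k"
    "unit_pendant_flow z" "\<forall>k\<in>{1..w}. cflow z k - cflow z (k - 1) = inflow z k - outflow z k"
    using z unfolding cut_polytope_iff[OF S] by auto
  have "from_cut z \<in> bidir_polytope"
    unfolding bidir_polytope_iff cong using *(3,4) from_cut_in_coord_space
    by (auto simp: vflow_from_cut)
  moreover have "vflow (from_cut z) i \<le> vflow (from_cut z) k" if "i \<in> S" "k \<in> {1..w}" for i k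
    using that S *(2) cflow_cut[OF *(1) S that(1)] by (auto simp: vflow_from_cut)
  ultimately show ?thesis by (simp add: min_cell_def)
qed

lemma from_cut_to_cut:
  assumes x: "x \<in> min_cell S" and S: "S \<subseteq> {1..w}" "i \<in> S"
  shows "from_cut (to_cut i S x) = x"
proof (rule poly_mapping_eqI)
  fix e
  have coord: "x \<in> coord_space (pendant_edges \<union> valley_path Bidir)"
    using x by (auto simp: min_cell_def bidir_polytope_iff)
  consider "e \<in> pendant_edges" | k where "k \<in> {1..<w}" "e = (val k, val (Suc k), Bidir)"
    | "e \<notin> pendant_edges \<union> valley_path Bidir"
    unfolding valley_path_def by blast
  then show "Poly_Mapping.lookup (from_cut (to_cut i S x)) e = Poly_Mapping.lookup x e"
  proof cases
    case 1
    then show ?thesis by (simp add: lookup_from_cut_pendant lookup_to_cut_pendant)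
  next
    case 2
    have "vflow (from_cut (to_cut i S x)) k = vflow x k"
      using 2 S vflow_from_cut[of k "to_cut i S x"] cflow_to_cut[OF x S] by simp
    then show ?thesis using 2 by (simp add: vflow_def)
  next
    case 3
    then show ?thesis
      using coord_space_zero[OF coord] by (simp add: from_cut_def lookup_coord_map)
  qed
qed

lemma to_cut_from_cut:
  assumes z: "z \<in> cut_polytope S" and S: "S \<subseteq> {1..w}" "i \<in> S"
  shows "to_cut i S (from_cut z) = z"
proof (rule poly_mapping_eqI)
  fix e
  have coord: "z \<in> coord_space (pendant_edges \<union> cut_cycle S)"
    using z by (auto simp: cut_polytope_iff[OF S(1)])
  consider "e \<in> pendant_edges" | k where "k \<in> {1..w}" "k \<notin> S" "e = cycle_edge k"
    | "e \<notin> pendant_edges \<union> cut_cycle S"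
    unfolding cut_cycle_def by blast
  then show "Poly_Mapping.lookup (to_cut i S (from_cut z)) e = Poly_Mapping.lookup z e"
  proof cases
    case 1
    then show ?thesis by (simp add: lookup_from_cut_pendant lookup_to_cut_pendant)
  next
    case 2
    have "i \<le> w" using S by auto
    then show ?thesis
      using 2 cflow_cut[OF coord S]
      by (simp add: lookup_to_cut_cycle_edge vflow_from_cut) (auto simp: cflow_def)
  next
    case 3
    then show ?thesis
      using coord_space_zero[OF coord] by (simp add: to_cut_def lookup_coord_map)
  qed
qed

lemma to_cut_image:
  assumes "S \<subseteq> {1..w}" "i \<in> S"
  shows "to_cut i S ` min_cell S = cut_polytope S"
  using assms to_cut_in_cut_polytope from_cut_in_min_cell to_cut_from_cut
  by (metis (no_types, lifting) image_eqI image_subsetI subsetI subset_antisym)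

lemma from_cut_image:
  assumes "S \<subseteq> {1..w}" "i \<in> S"
  shows "from_cut ` cut_polytope S = min_cell S"
  using assms to_cut_in_cut_polytope from_cut_in_min_cell from_cut_to_cut
  by (metis (no_types, lifting) image_eqI image_subsetI subsetI subset_antisym)

end

section \<open>Cells as convex hulls of routes\<close>

sublocale valley_tree \<subseteq> bidir: dart_graph "{0..Suc n}" "pendant_edges \<union> valley_path Bidir"
proof
  fix e assume e: "e \<in> pendant_edges \<union> valley_path Bidir"
  have le: "i \<le> Suc n" if "i \<in> I \<or> i \<in> J" for i
    using that I_range[of i] J_range[of i] by auto
  have "lo e \<le> Suc n \<and> hi e \<le> Suc n"
    using e
  proof (elim UnE)
    assume "e \<in> pendant_edges"
    then show ?thesis
      unfolding pendant_edges_def by (elim UnE imageE; simp add: le val_bI val_bJ)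
  next
    assume "e \<in> valley_path Bidir"
    then show ?thesis
      unfolding valley_path_def by (elim imageE) (simp add: le val_in_I)
  qed
  then show "lo e \<in> {0..Suc n}" "hi e \<in> {0..Suc n}" by simp_all
qed simp_all

context valley_tree
begin

section \<open>Routes with prescribed first and last edge\<close>

abbreviation "bidir_digraph \<equiv> dart_digraph verts_aug (pendant_edges \<union> valley_path Bidir)"

abbreviation "bidir_routes \<equiv> routes verts_aug (pendant_edges \<union> valley_path Bidir)"

lemma valleys_adjacent:
  assumes "k \<in> {1..<w}"
  shows "val k \<rightarrow>\<^bsub>bidir_digraph\<^esub> val (Suc k)" "val (Suc k) \<rightarrow>\<^bsub>bidir_digraph\<^esub> val k"
proof -
  let ?e = "(val k, val (Suc k), Bidir)"
  have "?e \<in> pendant_edges \<union> valley_path Bidir" using assms by (auto simp: valley_path_def)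
  then have "(?e, b) \<in> arcs bidir_digraph" for b
    by (simp add: bidir.arcs_D allowed_def)
  then show "val k \<rightarrow>\<^bsub>bidir_digraph\<^esub> val (Suc k)" "val (Suc k) \<rightarrow>\<^bsub>bidir_digraph\<^esub> val k"
    using bidir.dominatesI[of "(?e, True)"] bidir.dominatesI[of "(?e, False)"]
    by (auto simp: arc_to_ends_def bidir.tail_D bidir.head_D)
qed

lemma pendant_adjacent:
  assumes "(u, v, Fwd) \<in> pendant_edges"
  shows "((u, v, Fwd), True) \<in> arcs bidir_digraph" "u \<rightarrow>\<^bsub>bidir_digraph\<^esub> v"
proof -
  show "((u, v, Fwd), True) \<in> arcs bidir_digraph"
    using assms by (simp add: bidir.arcs_D allowed_def)
  from bidir.dominatesI[OF _ this] show "u \<rightarrow>\<^bsub>bidir_digraph\<^esub> v"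
    by (simp add: arc_to_ends_def bidir.tail_D bidir.head_D)
qed

lemma valleys_reachable:
  assumes "k \<in> {1..w}" "l \<in> {1..w}"
  shows "val k \<rightarrow>\<^sup>*\<^bsub>bidir_digraph\<^esub> val l"
proof -
  have refl: "val m \<rightarrow>\<^sup>*\<^bsub>bidir_digraph\<^esub> val m" if "m \<in> {1..w}" for m
    using val_in_I[OF that] I_range[of "val m"]
    by (intro bidir.reachable_refl) (auto simp: dart_digraph_def)
  have "val p \<rightarrow>\<^sup>*\<^bsub>bidir_digraph\<^esub> val q \<and> val q \<rightarrow>\<^sup>*\<^bsub>bidir_digraph\<^esub> val p"
    if "p \<le> q" "1 \<le> p" "q \<le> w" for p q
    using that
  proof (induction q rule: dec_induct)
    case base
    then show ?case using refl by simp
  next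
    case (step m)
    then have "m \<in> {1..<w}" by auto
    then show ?case
      using step valleys_adjacent[of m] bidir.reachable_adj_trans bidir.adj_reachable_trans
      by (meson Suc_leD)
  qed
  from this[of k l] this[of l k] show ?thesis
    using assms by (cases "k \<le> l") auto
qed

text \<open>A path from \<open>i\<close> to \<open>j\<close> through the valleys avoids source and
  sink, so the edge from the source and the edge to the sink can be attached without repeating a
  vertex.\<close>

lemma bidir_route_exists:
  assumes i: "i \<in> I" and j: "j \<in> J"
  obtains R where "R \<in> bidir_routes"
    and "((0, i, Fwd), True) \<in> set R" and "((j, Suc n, Fwd), True) \<in> set R"
proof -
  let ?G = bidir_digraph
  have "i \<rightarrow>\<^sup>*\<^bsub>?G\<^esub> val (bI i)"
  proof (cases "i \<in> J")
    case True
    then obtain k where "k \<in> {1..w}" "i = val k" using i I_Int_J by blast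
    then show ?thesis using valleys_reachable by simp
  next
    case False
    then show ?thesis
      using i pendant_edgesI(3) by (intro bidir.reachable_adjI pendant_adjacent(2)) auto
  qed
  also have "val (bI i) \<rightarrow>\<^sup>*\<^bsub>?G\<^esub> val (bJ j)"
    using i j bI_range bJ_range by (intro valleys_reachable) auto
  also have "val (bJ j) \<rightarrow>\<^sup>*\<^bsub>?G\<^esub> j"
  proof (cases "j \<in> I")
    case True
    then obtain k where "k \<in> {1..w}" "j = val k" using j I_Int_J by blast
    then show ?thesis using valleys_reachable by simp
  next
    case False
    then show ?thesis
      using j pendant_edgesI(4) by (intro bidir.reachable_adjI pendant_adjacent(2)) auto
  qed
  finally obtain p where p: "bidir.apath i p j"
    using bidir.reachable_apath by blast
  then have walk: "bidir.awalk i p j" by (rule bidir.awalkI_apath)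
  \<comment> \<open>No arc enters the source and none leaves the sink. Hence a walk from
    \<open>i\<close> misses the source, its vertices being \<open>i\<close> and heads, and a walk to
    \<open>j\<close> misses the sink, its vertices being \<open>j\<close> and tails.\<close>
  have arc: "head ?G d \<noteq> 0 \<and> tail ?G d \<noteq> Suc n" if "d \<in> arcs ?G" for d
  proof -
    from that have d: "fst d \<in> pendant_edges \<union> valley_path Bidir" "allowed d"
      by (simp_all add: bidir.arcs_D)
    have v: "val k \<noteq> 0" "val k \<noteq> Suc n" if "k \<in> {1..w}" for k
      using val_in_I[OF that] ends_notin by metis+
    show ?thesis
    proof (cases "fst d \<in> valley_path Bidir")
      case True
      then obtain k where "k \<in> {1..<w}" "fst d = (val k, val (Suc k), Bidir)"
        unfolding valley_path_def by blast
      then show ?thesis using v[of k] v[of "Suc k"] by (auto simp: bidir.tail_D bidir.head_D)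
    next
      case False
      then have e: "fst d \<in> pendant_edges" using d by blast
      then have "snd d"
        using d(2) by (cases d) (auto simp: pendant_edges_def allowed_def)
      moreover have "hi (fst d) \<noteq> 0 \<and> lo (fst d) \<noteq> Suc n"
        using e v bI_range bJ_range unfolding pendant_edges_def by (auto dest: I_range J_range)
      ultimately show ?thesis by (simp add: bidir.tail_D bidir.head_D)
    qed
  qed
  have arcs_p: "set p \<subseteq> arcs ?G" using walk by (simp add: bidir.awalk_def)
  have no0: "0 \<notin> set (bidir.awalk_verts i p)"
  proof -
    have "set (bidir.awalk_verts i p) = set (i # map (head ?G) p)"
      using walk by (subst bidir.awalk_verts_conv'[of i p j]) (auto simp: bidir.awalk_def bidir.cas_simp)
    moreover have "0 \<notin> set (i # map (head ?G) p)"
      using arc arcs_p i ends_notin by fastforce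
    ultimately show ?thesis by blast
  qed
  have not: "Suc n \<notin> set (bidir.awalk_verts i p)"
  proof -
    have "bidir.awlast i p = j" using walk by auto
    then have "set (bidir.awalk_verts i p) = set (j # map (tail ?G) p)"
      by (auto simp: bidir.awalk_verts_conv split: if_splits)
    moreover have "Suc n \<notin> set (j # map (tail ?G) p)"
      using arc arcs_p j ends_notin by fastforce
    ultimately show ?thesis by blast
  qed
  let ?first = "((0, i, Fwd), True)" and ?last = "((j, Suc n, Fwd), True)"
  have ends: "?first \<in> arcs ?G" "?last \<in> arcs ?G"
    using pendant_adjacent(1) pendant_edgesI(1,2) i j by blast+
  have "Suc n \<in> verts ?G" by (simp add: dart_digraph_def)
  then have last: "bidir.apath j [?last] (Suc n)"
    using ends(2) J_range[OF j] by (simp add: bidir.apath_simps bidir.tail_D bidir.head_D)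
  have awl: "bidir.awlast i p = j" using walk by auto
  have "bidir.apath i (p @ [?last]) (Suc n)"
    unfolding bidir.apath_append_iff awl using p last not
    by (simp add: bidir.head_D)
  moreover have "0 \<notin> set (bidir.awalk_verts i (p @ [?last]))"
    using no0 bidir.set_awalk_verts_append[OF walk bidir.awalkI_apath[OF last]]
      J_range[OF j] by (auto simp: bidir.tail_D bidir.head_D)
  ultimately have "bidir.apath 0 (?first # p @ [?last]) (Suc n)"
    using ends(1) by (simp add: bidir.apath_Cons_iff bidir.tail_D bidir.head_D)
  then have "?first # p @ [?last] \<in> bidir_routes"
    by (simp add: bidir.routes_eq)
  then show ?thesis by (rule that) simp_all
qed

text \<open>Summing conservation over the first \<open>k\<close> blocks: the flow across the cut
  behind block \<open>k\<close> is what the source feeds into these blocks minus what the sink draws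
  from them.\<close>

lemma vflow_eq_sum:
  assumes x: "x \<in> bidir_polytope" and k: "k \<le> w"
  shows "vflow x k = (\<Sum>i | i \<in> I \<and> bI i \<le> k. Poly_Mapping.lookup x (0, i, Fwd))
    - (\<Sum>j | j \<in> J \<and> bJ j \<le> k. Poly_Mapping.lookup x (j, Suc n, Fwd))"
  using k
proof (induction k)
  case 0
  have "{i. i \<in> I \<and> bI i \<le> 0} = {}" "{j. j \<in> J \<and> bJ j \<le> 0} = {}"
    using bI_range bJ_range by fastforce+
  then show ?case by (simp only: sum.empty vflow_0)
next
  case (Suc k)
  have split: "(\<Sum>i | i \<in> X \<and> b i \<le> Suc k. h i) = (\<Sum>i | i \<in> X \<and> b i \<le> k. h i) + (\<Sum>i | i \<in> X \<and> b i = Suc k. h i)"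
    if "finite X" for X :: "nat set" and b and h :: "nat \<Rightarrow> real"
  proof -
    have "{i. i \<in> X \<and> b i \<le> Suc k} = {i. i \<in> X \<and> b i \<le> k} \<union> {i. i \<in> X \<and> b i = Suc k}" by auto
    then show ?thesis using that by (simp add: sum.union_disjoint disjoint_iff)
  qed
  have "vflow x (Suc k) - vflow x k = inflow x (Suc k) - outflow x (Suc k)"
    using x Suc.prems by (auto simp: bidir_polytope_iff dest: bspec[of _ _ "Suc k"])
  then show ?case
    using Suc unfolding split[OF finite_I] split[OF finite_J] by simp
qed

text \<open>Pendant edges repeat the values at the source and the sink, and valley edges are
  differences of partial sums of them. This is how a convex combination of routes is recognized as a
  given flow.\<close>

lemma bidir_polytope_eqI:
  assumes x: "x \<in> bidir_polytope" and y: "y \<in> bidir_polytope"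
    and p: "\<And>i. i \<in> I \<Longrightarrow> Poly_Mapping.lookup x (0, i, Fwd) = Poly_Mapping.lookup y (0, i, Fwd)"
    and q: "\<And>j. j \<in> J \<Longrightarrow> Poly_Mapping.lookup x (j, Suc n, Fwd) = Poly_Mapping.lookup y (j, Suc n, Fwd)"
  shows "x = y"
proof (rule poly_mapping_eqI)
  fix e
  consider "e \<in> pendant_edges" | k where "k \<in> {1..<w}" "e = (val k, val (Suc k), Bidir)"
    | "e \<notin> pendant_edges \<union> valley_path Bidir"
    unfolding valley_path_def by blast
  then show "Poly_Mapping.lookup x e = Poly_Mapping.lookup y e"
  proof cases
    case 1
    have "unit_pendant_flow x" "unit_pendant_flow y"
      using x y by (simp_all only: bidir_polytope_iff)
    then show ?thesis
      using 1 p q unfolding unit_pendant_flow_def pendant_edges_def by auto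
  next
    case 2
    have "vflow x k = vflow y k"
      unfolding vflow_eq_sum[OF x less_imp_le, of k] using 2 p q
      by (subst (1 2) vflow_eq_sum) (auto simp: x y intro!: arg_cong2[of _ _ _ _ "(-)"] sum.cong)
    then show ?thesis using 2 by (simp add: vflow_def)
  next
    case 3
    then show ?thesis
      using x y by (metis bidir_polytope_iff coord_space_zero)
  qed
qed

lemma sum_eq_1_imp_of_bool:
  fixes h :: "nat \<Rightarrow> real"
  assumes "finite X" "\<And>i. i \<in> X \<Longrightarrow> 0 \<le> h i" "sum h X = 1" "i \<in> X" "h i = 1" "k \<in> X"
  shows "h k = of_bool (k = i)"
proof -
  have "sum h (X - {i}) = 0" using assms by (simp add: sum_diff1)
  then have "\<forall>k\<in>X - {i}. h k = 0" using assms by (subst (asm) sum_nonneg_eq_0_iff) auto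
  then show ?thesis using assms by auto
qed

text \<open>The choice is immaterial: the characteristic vector is determined by its values at the
  source and the sink, so all routes with these end edges give the same one.\<close>

definition unit_flow :: "nat \<Rightarrow> nat \<Rightarrow> (nat edge \<Rightarrow>\<^sub>0 real)" where
  "unit_flow i j = char_vec (SOME R. R \<in> bidir_routes
     \<and> ((0, i, Fwd), True) \<in> set R \<and> ((j, Suc n, Fwd), True) \<in> set R)"

lemma unit_flow_route:
  assumes "i \<in> I" "j \<in> J"
  obtains R where "R \<in> bidir_routes" "unit_flow i j = char_vec R"
    "((0, i, Fwd), True) \<in> set R" "((j, Suc n, Fwd), True) \<in> set R"
proof -
  have "\<exists>R. R \<in> bidir_routes \<and> ((0, i, Fwd), True) \<in> set R \<and> ((j, Suc n, Fwd), True) \<in> set R"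
    using bidir_route_exists[OF assms] by metis
  from someI_ex[OF this] show ?thesis using that unfolding unit_flow_def by blast
qed

lemma unit_flow_in_bidir_polytope:
  assumes "i \<in> I" "j \<in> J"
  shows "unit_flow i j \<in> bidir_polytope"
  using unit_flow_route[OF assms] bidir.char_vec_in_flow_polytope by metis

text \<open>The values at the source are nonnegative with sum 1 and one of them is already 1, so the
  others vanish; the same holds at the sink.\<close>

lemma lookup_unit_flow:
  assumes ij: "i \<in> I" "j \<in> J"
  shows "k \<in> I \<Longrightarrow> Poly_Mapping.lookup (unit_flow i j) (0, k, Fwd) = of_bool (k = i)"
    and "k \<in> J \<Longrightarrow> Poly_Mapping.lookup (unit_flow i j) (k, Suc n, Fwd) = of_bool (k = j)"
proof -
  obtain R where R: "R \<in> bidir_routes" "unit_flow i j = char_vec R"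
    "((0, i, Fwd), True) \<in> set R" "((j, Suc n, Fwd), True) \<in> set R"
    using unit_flow_route[OF ij] .
  then have one: "Poly_Mapping.lookup (unit_flow i j) (0, i, Fwd) = 1"
    "Poly_Mapping.lookup (unit_flow i j) (j, Suc n, Fwd) = 1"
    by (simp_all add: bidir.lookup_char_vec_route)
  have u: "unit_pendant_flow (unit_flow i j)"
    using unit_flow_in_bidir_polytope[OF ij] by (simp only: bidir_polytope_iff)
  show "Poly_Mapping.lookup (unit_flow i j) (0, k, Fwd) = of_bool (k = i)" if "k \<in> I"
    by (rule sum_eq_1_imp_of_bool[OF finite_I])
      (use u one ij that pendant_edgesI in \<open>auto simp: unit_pendant_flow_def\<close>)
  show "Poly_Mapping.lookup (unit_flow i j) (k, Suc n, Fwd) = of_bool (k = j)" if "k \<in> J"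
    by (rule sum_eq_1_imp_of_bool[OF finite_J])
      (use u one ij that pendant_edgesI in \<open>auto simp: unit_pendant_flow_def\<close>)
qed

lemma vflow_unit_flow:
  assumes ij: "i \<in> I" "j \<in> J" and k: "k \<le> w"
  shows "vflow (unit_flow i j) k = of_bool (bI i \<le> k) - of_bool (bJ j \<le> k)"
proof -
  have "(\<Sum>i' | i' \<in> I \<and> bI i' \<le> k. Poly_Mapping.lookup (unit_flow i j) (0, i', Fwd))
      = (\<Sum>i' | i' \<in> I \<and> bI i' \<le> k. if i' = i then 1 else 0)"
    by (rule sum.cong[OF refl]) (simp add: lookup_unit_flow[OF ij])
  moreover have "(\<Sum>j' | j' \<in> J \<and> bJ j' \<le> k. Poly_Mapping.lookup (unit_flow i j) (j', Suc n, Fwd))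
      = (\<Sum>j' | j' \<in> J \<and> bJ j' \<le> k. if j' = j then 1 else 0)"
    by (rule sum.cong[OF refl]) (simp add: lookup_unit_flow[OF ij])
  ultimately show ?thesis
    unfolding vflow_eq_sum[OF unit_flow_in_bidir_polytope[OF ij] k] using ij by simp
qed

section \<open>Decomposition of the flows of a cell into routes\<close>

lemma convex_min_cell: "convex (min_cell S)"
proof (rule convexI)
  fix x y and u v :: real
  assume "x \<in> min_cell S" "y \<in> min_cell S" "0 \<le> u" "0 \<le> v" "u + v = 1"
  moreover have "vflow (u *\<^sub>R x + v *\<^sub>R y) k = u * vflow x k + v * vflow y k" for k
    by (simp add: linear_add[OF linear_vflow] linear_scale[OF linear_vflow])
  ultimately show "u *\<^sub>R x + v *\<^sub>R y \<in> min_cell S"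
    unfolding min_cell_def
    using convexD[OF bidir.convex_flow_polytope, of x y u v]
    by (auto intro!: add_mono mult_left_mono)
qed

text \<open>
  Read cyclically, starting after the \<open>c\<close>-th valley, the blocks are ordered by \<open>cyc_rank c\<close>. On the
  cell where \<open>vflow x c\<close> is minimal, the pendant flow from the source then dominates the one to the
  sink, so that it can be coupled along routes which never cross from valley \<open>c\<close> to valley
  \<open>c + 1\<close>.
\<close>

definition cyc_rank :: "nat \<Rightarrow> nat \<Rightarrow> nat" where
  "cyc_rank c k = (if c < k then k else k + w)"

text \<open>An initial segment of the cyclic order is an interval of blocks starting at
  \<open>c + 1\<close>, followed after wrapping around by an interval starting at 1. The
  \<open>min\<close> caps the second interval at \<open>c\<close>, where the cyclic order
  ends.\<close>

lemma sum_cyc_rank: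
  fixes h :: "nat \<Rightarrow> real"
  assumes X: "finite X" "\<And>i. i \<in> X \<Longrightarrow> b i \<in> {1..w}" and c: "c \<in> {1..w}"
  defines "A \<equiv> \<lambda>k. \<Sum>i | i \<in> X \<and> b i \<le> k. h i"
  shows "(\<Sum>i | i \<in> X \<and> cyc_rank c (b i) \<le> m. h i) =
    (if m \<le> c then 0 else if m \<le> w then A m - A c else A w - A c + A (min (m - w) c))"
proof -
  have diff: "(\<Sum>i | i \<in> X \<and> c < b i \<and> b i \<le> k. h i) = A k - A c" if "c \<le> k" for k
  proof -
    have "{i. i \<in> X \<and> b i \<le> k} = {i. i \<in> X \<and> b i \<le> c} \<union> {i. i \<in> X \<and> c < b i \<and> b i \<le> k}"
      using that by auto
    then have "A k = A c + (\<Sum>i | i \<in> X \<and> c < b i \<and> b i \<le> k. h i)"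
      unfolding A_def using X(1) by (simp add: sum.union_disjoint disjoint_iff)
    then show ?thesis by simp
  qed
  consider "m \<le> c" | "c < m" "m \<le> w" | "w < m" using c by fastforce
  then show ?thesis
  proof cases
    case 1
    have "{i. i \<in> X \<and> cyc_rank c (b i) \<le> m} = {}"
      using 1 X(2) c by (force simp: cyc_rank_def)
    then show ?thesis using 1 by (simp only: sum.empty if_True)
  next
    case 2
    have "{i. i \<in> X \<and> cyc_rank c (b i) \<le> m} = {i. i \<in> X \<and> c < b i \<and> b i \<le> m}"
      using 2 X(2) by (force simp: cyc_rank_def)
    then show ?thesis using 2 diff[of m] by simp
  next
    case 3
    have "{i. i \<in> X \<and> cyc_rank c (b i) \<le> m}
        = {i. i \<in> X \<and> c < b i \<and> b i \<le> w} \<union> {i. i \<in> X \<and> b i \<le> min (m - w) c}"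
      using 3 X(2) c by (force simp: cyc_rank_def)
    then have "(\<Sum>i | i \<in> X \<and> cyc_rank c (b i) \<le> m. h i)
        = (\<Sum>i | i \<in> X \<and> c < b i \<and> b i \<le> w. h i) + A (min (m - w) c)"
      unfolding A_def using X(1) by (simp add: sum.union_disjoint disjoint_iff)
    then show ?thesis using 3 c diff[of w] by simp
  qed
qed

text \<open>The right side minus the left side is 0 up to level \<open>c\<close>, then
  \<open>vflow x m - vflow x c\<close>, and after wrapping around
  \<open>vflow x (min (m - w) c) - vflow x c\<close>, since \<open>vflow x w = 0\<close>. Minimality
  at \<open>c\<close> makes all of these nonnegative.\<close>

lemma min_cell_dominance:
  assumes c: "c \<in> {1..w}" and x: "x \<in> min_cell {c}"
  shows "(\<Sum>j | j \<in> J \<and> cyc_rank c (bJ j) \<le> m. Poly_Mapping.lookup x (j, Suc n, Fwd))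
    \<le> (\<Sum>i | i \<in> I \<and> cyc_rank c (bI i) \<le> m. Poly_Mapping.lookup x (0, i, Fwd))"
proof -
  have B: "x \<in> bidir_polytope" and min: "\<And>k. k \<in> {1..w} \<Longrightarrow> vflow x c \<le> vflow x k"
    using x by (auto simp: min_cell_def)
  define P where "P k = (\<Sum>i | i \<in> I \<and> bI i \<le> k. Poly_Mapping.lookup x (0, i, Fwd))" for k
  define Q where "Q k = (\<Sum>j | j \<in> J \<and> bJ j \<le> k. Poly_Mapping.lookup x (j, Suc n, Fwd))" for k
  have v: "vflow x k = P k - Q k" if "k \<le> w" for k
    unfolding P_def Q_def by (rule vflow_eq_sum[OF B that])
  have sP: "(\<Sum>i | i \<in> I \<and> cyc_rank c (bI i) \<le> m. Poly_Mapping.lookup x (0, i, Fwd)) =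
      (if m \<le> c then 0 else if m \<le> w then P m - P c else P w - P c + P (min (m - w) c))"
    unfolding P_def by (rule sum_cyc_rank[OF finite_I _ c]) (rule bI_range)
  have sQ: "(\<Sum>j | j \<in> J \<and> cyc_rank c (bJ j) \<le> m. Poly_Mapping.lookup x (j, Suc n, Fwd)) =
      (if m \<le> c then 0 else if m \<le> w then Q m - Q c else Q w - Q c + Q (min (m - w) c))"
    unfolding Q_def by (rule sum_cyc_rank[OF finite_J _ c]) (rule bJ_range)
  have cw: "c \<le> w" "min (m - w) c \<le> w" using c by auto
  consider "m \<le> c" | "c < m" "m \<le> w" | "w < m" by linarith
  then show ?thesis
  proof cases
    case 1
    then show ?thesis unfolding sP sQ by simp
  next
    case 2
    then show ?thesis
      using min[of m] v[of m] v[OF cw(1)] unfolding sP sQ by simp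
  next
    case 3
    then have "vflow x c \<le> vflow x (min (m - w) c)" using min[of "min (m - w) c"] c by fastforce
    then show ?thesis
      using 3 cw(1) v[OF cw(1)] v[OF cw(2)] v[of w] vflow_w[of x] unfolding sP sQ by simp
  qed
qed

text \<open>Any \<open>c\<close> in \<open>S\<close> supplies a coupling whose weights express
  \<open>x\<close> by unit flows with minimum at \<open>c\<close>; that the minimum is also attained
  on the rest of \<open>S\<close> then follows because averages of nonnegative gaps vanish only
  termwise.\<close>

lemma min_cell_hull:
  assumes S: "S \<subseteq> {1..w}" "S \<noteq> {}"
  shows "min_cell S = convex hull (char_vec ` {R \<in> bidir_routes. char_vec R \<in> min_cell S})"
proof
  show "convex hull (char_vec ` {R \<in> bidir_routes. char_vec R \<in> min_cell S}) \<subseteq> min_cell S"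
    by (rule hull_minimal[where S = convex, OF _ convex_min_cell]) blast
  show "min_cell S \<subseteq> convex hull (char_vec ` {R \<in> bidir_routes. char_vec R \<in> min_cell S})"
  proof
    fix x assume x: "x \<in> min_cell S"
    obtain c where cS: "c \<in> S" using S by blast
    then have c: "c \<in> {1..w}" using S by blast
    have xc: "x \<in> min_cell {c}" using x cS by (auto simp: min_cell_def)
    have B: "x \<in> bidir_polytope" using x by (simp add: min_cell_def)
    let ?p = "\<lambda>i. Poly_Mapping.lookup x (0, i, Fwd)" and ?q = "\<lambda>j. Poly_Mapping.lookup x (j, Suc n, Fwd)"
    have u: "unit_pendant_flow x" using B by (simp only: bidir_polytope_iff)
    obtain a where a: "\<And>i j. i \<in> I \<Longrightarrow> j \<in> J \<Longrightarrow> 0 \<le> a i j"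
      "\<And>i j. i \<in> I \<Longrightarrow> j \<in> J \<Longrightarrow> a i j \<noteq> 0 \<Longrightarrow> cyc_rank c (bI i) \<le> cyc_rank c (bJ j)"
      "\<And>i. i \<in> I \<Longrightarrow> (\<Sum>j\<in>J. a i j) = ?p i" "\<And>j. j \<in> J \<Longrightarrow> (\<Sum>i\<in>I. a i j) = ?q j"
    proof (rule monotone_coupling[where A = I and B = J and p = ?p and q = ?q
          and f = "\<lambda>i. cyc_rank c (bI i)" and g = "\<lambda>j. cyc_rank c (bJ j)"])
      show "0 \<le> ?p i" if "i \<in> I" for i
        using u pendant_edgesI(1)[OF that] by (simp add: unit_pendant_flow_def)
      show "0 \<le> ?q j" if "j \<in> J" for j
        using u pendant_edgesI(2)[OF that] by (simp add: unit_pendant_flow_def)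
      show "sum ?p I = sum ?q J" using u by (simp add: unit_pendant_flow_def)
    qed (use min_cell_dominance[OF c xc] in auto)
    define P where "P = {(i, j). i \<in> I \<and> j \<in> J \<and> a i j \<noteq> 0}"
    define y where "y = (\<Sum>(i, j)\<in>P. a i j *\<^sub>R unit_flow i j)"
    have finP: "finite P" by (rule finite_subset[of _ "I \<times> J"]) (auto simp: P_def)
    have sumP: "(\<Sum>(i, j)\<in>P. a i j * h i j) = (\<Sum>i\<in>I. \<Sum>j\<in>J. a i j * h i j)" for h
    proof -
      have "(\<Sum>(i, j)\<in>P. a i j * h i j) = (\<Sum>(i, j)\<in>I \<times> J. a i j * h i j)"
        by (rule sum.mono_neutral_left) (auto simp: P_def)
      then show ?thesis by (simp add: sum.cartesian_product)
    qed
    have tot: "(\<Sum>(i, j)\<in>P. a i j) = 1"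
      using sumP[of "\<lambda>_ _. 1"] a(3) u by (simp add: unit_pendant_flow_def)
    have comb: "y \<in> C" if "convex C" "\<And>i j. (i, j) \<in> P \<Longrightarrow> unit_flow i j \<in> C" for C
      unfolding y_def using convex_sum[OF finP that(1), of "\<lambda>(i, j). a i j" "\<lambda>(i, j). unit_flow i j"]
        tot a(1) that(2) by (auto simp: P_def split_beta)
    have lookup_y: "Poly_Mapping.lookup y e = (\<Sum>i\<in>I. \<Sum>j\<in>J. a i j * Poly_Mapping.lookup (unit_flow i j) e)" for e
      unfolding sumP[symmetric] y_def
      by (simp add: lookup_sum lookup_scaleR split_beta)
    have yB: "y \<in> bidir_polytope"
      by (rule comb[OF bidir.convex_flow_polytope]) (simp add: P_def unit_flow_in_bidir_polytope)
    have "x = y"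
    proof (rule bidir_polytope_eqI[OF B yB])
      fix k assume k: "k \<in> I"
      have "Poly_Mapping.lookup y (0, k, Fwd) = (\<Sum>i\<in>I. \<Sum>j\<in>J. a i j * of_bool (k = i))"
        unfolding lookup_y by (intro sum.cong refl) (simp add: lookup_unit_flow k)
      also have "\<dots> = (\<Sum>i\<in>I. if k = i then \<Sum>j\<in>J. a i j else 0)"
        by (intro sum.cong refl) simp
      also have "\<dots> = ?p k" using k a(3) by simp
      finally show "?p k = Poly_Mapping.lookup y (0, k, Fwd)" by simp
    next
      fix k assume k: "k \<in> J"
      have "Poly_Mapping.lookup y (k, Suc n, Fwd) = (\<Sum>i\<in>I. \<Sum>j\<in>J. a i j * of_bool (k = j))"
        unfolding lookup_y by (intro sum.cong refl) (simp add: lookup_unit_flow k)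
      also have "\<dots> = (\<Sum>j\<in>J. \<Sum>i\<in>I. a i j * of_bool (k = j))" by (rule sum.swap)
      also have "\<dots> = (\<Sum>j\<in>J. if k = j then \<Sum>i\<in>I. a i j else 0)"
        by (intro sum.cong refl) simp
      also have "\<dots> = ?q k" using k a(4) by simp
      finally show "?q k = Poly_Mapping.lookup y (k, Suc n, Fwd)" by simp
    qed
    moreover have "y \<in> convex hull (char_vec ` {R \<in> bidir_routes. char_vec R \<in> min_cell S})"
    proof (rule comb[OF convex_convex_hull])
      \<comment> \<open>The rank order rules out only \<open>bI i \<le> c < bJ j\<close>, a forward
        crossing at \<open>c\<close>. If both blocks lie on one side of the cut, the route runs
        forward and has value 0 at \<open>c\<close>; otherwise it runs backward across
        \<open>c\<close> and has the least possible value -1 there.\<close>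
      have min_c: "vflow (unit_flow i j) c \<le> vflow (unit_flow i j) k"
        if "(i, j) \<in> P" "k \<in> {1..w}" for i j k
      proof -
        have ij: "i \<in> I" "j \<in> J" "cyc_rank c (bI i) \<le> cyc_rank c (bJ j)"
          using that(1) a(2) by (auto simp: P_def)
        then show ?thesis
          using that(2) c bI_range[OF ij(1)] bJ_range[OF ij(2)]
          by (auto simp: vflow_unit_flow cyc_rank_def split: if_splits)
      qed
      \<comment> \<open>The gaps between \<open>s\<close> and \<open>c\<close> are nonnegative and
        their weighted sum is the gap of \<open>x\<close>, which is 0; as the weights on
        \<open>P\<close> are nonzero, each gap vanishes.\<close>
      have eq: "vflow (unit_flow i j) s = vflow (unit_flow i j) c" if ij: "(i, j) \<in> P" and s: "s \<in> S" for i j s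
      proof -
        let ?g = "\<lambda>(i, j). a i j * (vflow (unit_flow i j) s - vflow (unit_flow i j) c)"
        have v: "vflow y k = (\<Sum>(i, j)\<in>P. a i j * vflow (unit_flow i j) k)" for k
          unfolding y_def linear_sum[OF linear_vflow] split_beta linear_scale[OF linear_vflow] by simp
        have "sum ?g P = vflow y s - vflow y c"
          unfolding v sum_subtractf[symmetric] by (rule sum.cong) (auto simp: algebra_simps)
        also have "\<dots> = 0"
          using min_cell_vflow_eq[OF x S(1) s cS] \<open>x = y\<close> by simp
        finally have "sum ?g P = 0" .
        moreover have "0 \<le> ?g t" if "t \<in> P" for t
          using that min_c[of "fst t" "snd t" s] a(1) s S by (auto simp: P_def)
        ultimately have "\<forall>t\<in>P. ?g t = 0"
          using finP by (subst (asm) sum_nonneg_eq_0_iff) auto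
        then show ?thesis using ij by (auto simp: P_def)
      qed
      fix i j assume ij: "(i, j) \<in> P"
      then have IJ: "i \<in> I" "j \<in> J" by (auto simp: P_def)
      obtain R where R: "R \<in> bidir_routes" "unit_flow i j = char_vec R"
        using unit_flow_route[OF IJ] .
      have "unit_flow i j \<in> min_cell S"
        using unit_flow_in_bidir_polytope[OF IJ] eq[OF ij] min_c[OF ij] by (simp add: min_cell_def)
      then show "unit_flow i j \<in> convex hull (char_vec ` {R \<in> bidir_routes. char_vec R \<in> min_cell S})"
        using R by (intro hull_inc) auto
    qed
    ultimately show "x \<in> convex hull (char_vec ` {R \<in> bidir_routes. char_vec R \<in> min_cell S})"
      by simp
  qed
qed

lemma lattice_polytope_min_cell:
  assumes "S \<subseteq> {1..w}" "S \<noteq> {}"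
  shows "lattice_polytope (min_cell S)"
  unfolding lattice_polytope_def
  using min_cell_hull[OF assms] bidir.finite_routes bidir.char_vec_integral
  by (intro exI[of _ "char_vec ` {R \<in> bidir_routes. char_vec R \<in> min_cell S}"]) auto

lemma polytope_min_cell:
  assumes "S \<subseteq> {1..w}" "S \<noteq> {}"
  shows "polytope (min_cell S)"
  using lattice_polytope_min_cell[OF assms] unfolding lattice_polytope_def polytope_def by blast

lemma min_cell_integrally_equivalent:
  assumes S: "S \<subseteq> {1..w}" "S \<noteq> {}"
  shows "integrally_equivalent (min_cell S) (cut_polytope S)"
proof -
  obtain i where i: "i \<in> S" using S by blast
  show ?thesis
    using lattice_polytope_min_cell[OF S] linear_to_cut linear_from_cut to_cut_integral
      from_cut_integral to_cut_image[OF S(1) i] from_cut_to_cut[OF _ S(1) i]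
    by (rule integrally_equivalentI)
qed

section \<open>The subdivision and its relative interiors\<close>

lemma bidir_polytope_eq_Union: "bidir_polytope = (\<Union>i\<in>{1..w}. min_cell {i})"
proof
  show "bidir_polytope \<subseteq> (\<Union>i\<in>{1..w}. min_cell {i})"
  proof
    fix x assume x: "x \<in> bidir_polytope"
    have "finite (vflow x ` {1..w})" "vflow x ` {1..w} \<noteq> {}" using w_pos by auto
    from Min_in[OF this] obtain i where i: "i \<in> {1..w}" "Min (vflow x ` {1..w}) = vflow x i" by blast
    then have "\<forall>k\<in>{1..w}. vflow x i \<le> vflow x k"
      by (metis Min_le finite_atLeastAtMost finite_imageI imageI)
    then show "x \<in> (\<Union>i\<in>{1..w}. min_cell {i})" using x i(1) by (auto simp: min_cell_def)
  qed
qed (auto simp: min_cell_def)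

lemma disjoint_rel_interior_min_cell:
  "disjoint_family_on (\<lambda>i. rel_interior (min_cell {i})) {1..w}"
proof -
  have False if ik: "i \<in> {1..w}" "k \<in> {1..w}" "i \<noteq> k"
    and x: "x \<in> rel_interior (min_cell {i})" "x \<in> rel_interior (min_cell {k})" for i k x
  proof -
    \<comment> \<open>The route entering at valley \<open>k\<close> and leaving at valley
      \<open>i\<close> witnesses that the gap \<open>vflow x k - vflow x i\<close> is not
      identically 0 on cell \<open>i\<close>: for \<open>k < i\<close> the two values are 1 and 0,
      for \<open>k > i\<close> they are 0 and -1.\<close>
    let ?z = "unit_flow (val k) (val i)"
    have IJ: "val k \<in> I" "val i \<in> J" using ik val_in_I val_in_J by blast+
    have z: "vflow ?z l = of_bool (k \<le> l) - of_bool (i \<le> l)" if "l \<le> w" for l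
      using vflow_unit_flow[OF IJ that] ik by simp
    have z_cell: "?z \<in> min_cell {i}"
      using unit_flow_in_bidir_polytope[OF IJ] z ik by (auto simp: min_cell_def)
    have z_pos: "0 < vflow ?z k - vflow ?z i" using z[of k] z[of i] ik by auto
    have lin: "linear (\<lambda>x. vflow x k - vflow x i)"
      by (intro linear_compose_sub linear_vflow)
    have nonneg: "0 \<le> vflow y k - vflow y i" if "y \<in> min_cell {i}" for y
      using that ik by (simp add: min_cell_def)
    have "0 < vflow x k - vflow x i"
      by (rule rel_interior_linear_pos[OF lin nonneg z_cell z_pos x(1)])
    moreover have "vflow x k \<le> vflow x i"
      using x(2) rel_interior_subset ik by (fastforce simp: min_cell_def)
    ultimately show False by simp
  qed
  then show ?thesis unfolding disjoint_family_on_def by blast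
qed

section \<open>Comparison with the given cells and graphs\<close>

lemma pendant_edges_Fwd: "e \<in> pendant_edges \<Longrightarrow> etype e = Fwd"
  by (auto simp: pendant_edges_def)

text \<open>On a route all valley flows are -1, 0 or 1, and backward traversals occur on valley
  edges only. As index \<open>w\<close> contributes 0, the value at \<open>i\<close> is minimal iff
  it is not 1 and equals -1 whenever -1 occurs.\<close>

lemma char_vec_in_min_cell_iff:
  assumes i: "1 \<le> i" "i < w" and R: "R \<in> bidir_routes"
  shows "char_vec R \<in> min_cell {i} \<longleftrightarrow> ((val i, val (Suc i), Bidir), True) \<notin> set R
    \<and> ((\<exists>e. (e, False) \<in> set R) \<longrightarrow> ((val i, val (Suc i), Bidir), False) \<in> set R)"
proof -
  let ?e = "\<lambda>k. (val k, val (Suc k), Bidir)"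
  have v: "vflow (char_vec R) k = (if (?e k, True) \<in> set R then 1 else if (?e k, False) \<in> set R then - 1 else 0)"
    if "1 \<le> k" "k < w" for k
    using that by (simp add: vflow_def lookup_char_vec)
  have once: "(?e k, False) \<in> set R \<Longrightarrow> (?e k, True) \<notin> set R" for k
    using bidir.route_edge_once[OF R] by blast
  have back_edge: "\<exists>k. 1 \<le> k \<and> k < w \<and> (?e k, False) \<in> set R" if "(e, False) \<in> set R" for e
  proof -
    have "e \<in> pendant_edges \<union> valley_path Bidir" "allowed (e, False)"
      using bidir.route_arcs[OF R that] by simp_all
    moreover have "e \<notin> pendant_edges"
      using calculation(2) pendant_edges_Fwd[of e] by (auto simp: allowed_def)
    ultimately show ?thesis using that unfolding valley_path_def by auto
  qed
  have "char_vec R \<in> min_cell {i} \<longleftrightarrow> (\<forall>k\<in>{1..w}. vflow (char_vec R) i \<le> vflow (char_vec R) k)"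
    using bidir.char_vec_in_flow_polytope[OF R] by (simp add: min_cell_def)
  also have "\<dots> \<longleftrightarrow> (?e i, True) \<notin> set R \<and> ((\<exists>e. (e, False) \<in> set R) \<longrightarrow> (?e i, False) \<in> set R)"
  proof (intro iffI conjI impI ballI)
    assume min: "\<forall>k\<in>{1..w}. vflow (char_vec R) i \<le> vflow (char_vec R) k"
    have "vflow (char_vec R) i \<le> 0" using bspec[OF min, of w] w_pos by simp
    then show "(?e i, True) \<notin> set R" using v[OF i] by auto
    assume "\<exists>e. (e, False) \<in> set R"
    then obtain k where k: "1 \<le> k" "k < w" "(?e k, False) \<in> set R" using back_edge by blast
    then have "vflow (char_vec R) i \<le> - 1"
      using bspec[OF min, of k] v[of k] once[of k] by simp
    then show "(?e i, False) \<in> set R" using v[OF i] by (auto split: if_splits)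
  next
    fix k assume R': "(?e i, True) \<notin> set R \<and> ((\<exists>e. (e, False) \<in> set R) \<longrightarrow> (?e i, False) \<in> set R)"
      and k: "k \<in> {1..w}"
    show "vflow (char_vec R) i \<le> vflow (char_vec R) k"
    proof (cases "k = w")
      case True
      then show ?thesis using R' v[OF i] by simp
    next
      case False
      then show ?thesis using k R' v[OF i] v[of k] by auto
    qed
  qed
  finally show ?thesis .
qed

lemma cut_cycle_last: "cut_cycle {w} = valley_path Fwd"
proof -
  have "{1..w} - {w} = {1..<w}" by auto
  then show ?thesis by (auto simp: cut_cycle_def valley_path_def cycle_edge_def)
qed

text \<open>With the backward edge cut, the shift in \<open>from_cut\<close> is 0, so this map only
  renames forward coordinates to bidirectional ones; the identification of coordinates on the right
  says precisely \<open>x = from_cut y\<close>.\<close>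

lemma min_cell_last:
  "min_cell {w} = {x \<in> coord_space (pendant_edges \<union> valley_path Bidir).
     \<exists>y \<in> cut_polytope {w}. \<forall>(i, j, d) \<in> pendant_edges \<union> valley_path Bidir.
       Poly_Mapping.lookup x (i, j, d) = Poly_Mapping.lookup y (i, j, Fwd)}"
proof -
  have w: "{w} \<subseteq> {1..w}" "w \<in> {w}" using w_pos by auto
  have "x \<in> coord_space (pendant_edges \<union> valley_path Bidir) \<and>
      (\<forall>(i, j, d) \<in> pendant_edges \<union> valley_path Bidir.
         Poly_Mapping.lookup x (i, j, d) = Poly_Mapping.lookup y (i, j, Fwd)) \<longleftrightarrow> x = from_cut y"
    if y: "y \<in> cut_polytope {w}" for x y
  proof -
    have "cflow y w = 0"
      using y cflow_cut[OF _ w] by (simp only: cut_polytope_iff[OF w(1)])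
    then have from_cut: "Poly_Mapping.lookup (from_cut y) (i, j, d) = Poly_Mapping.lookup y (i, j, Fwd)"
      if "(i, j, d) \<in> pendant_edges \<union> valley_path Bidir" for i j d
      using that pendant_edges_Fwd[of "(i, j, d)"] by (auto simp: from_cut_def lookup_coord_map)
    show ?thesis
    proof
      assume x: "x \<in> coord_space (pendant_edges \<union> valley_path Bidir) \<and>
        (\<forall>(i, j, d) \<in> pendant_edges \<union> valley_path Bidir.
           Poly_Mapping.lookup x (i, j, d) = Poly_Mapping.lookup y (i, j, Fwd))"
      show "x = from_cut y"
      proof (rule poly_mapping_eqI)
        fix e
        show "Poly_Mapping.lookup x e = Poly_Mapping.lookup (from_cut y) e"
        proof (cases "e \<in> pendant_edges \<union> valley_path Bidir")
          case True
          then show ?thesis using x from_cut by (cases e) fastforce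
        next
          case False
          then show ?thesis
            using x coord_space_zero[OF from_cut_in_coord_space False] coord_space_zero by metis
        qed
      qed
    next
      assume "x = from_cut y"
      then show "x \<in> coord_space (pendant_edges \<union> valley_path Bidir) \<and>
        (\<forall>(i, j, d) \<in> pendant_edges \<union> valley_path Bidir.
           Poly_Mapping.lookup x (i, j, d) = Poly_Mapping.lookup y (i, j, Fwd))"
        using from_cut from_cut_in_coord_space by blast
    qed
  qed
  then show ?thesis
    unfolding from_cut_image[OF w, symmetric] by blast
qed

text \<open>Because the edges of the cycle are distinct, removing an index removes exactly one edge,
  and intersecting the complements removes all edges of \<open>S\<close>.\<close>

lemma Inter_cut_cycle:
  assumes "S \<subseteq> {1..w}" "S \<noteq> {}"
  shows "(\<Inter>i\<in>S. pendant_edges \<union> cut_cycle {i}) = pendant_edges \<union> cut_cycle S"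
proof -
  have inj: "inj_on cycle_edge {1..w}" using cycle_edge_eq_iff by (auto intro: inj_onI)
  have "cut_cycle T = cycle_edge ` {1..w} - cycle_edge ` T" if "T \<subseteq> {1..w}" for T
    using inj_on_image_set_diff[OF inj _ that, of "{1..w}"] by (simp add: cut_cycle_def)
  then have "cut_cycle {i} = cycle_edge ` {1..w} - {cycle_edge i}" if "i \<in> S" for i
    using that assms(1) by (metis empty_subsetI image_empty image_insert insert_subset subsetD)
  moreover have "cut_cycle S = cycle_edge ` {1..w} - cycle_edge ` S"
    using inj_on_image_set_diff[OF inj _ assms(1), of "{1..w}"] by (simp add: cut_cycle_def)
  ultimately show ?thesis using assms(2) by auto
qed

lemma Inter_min_cell: "S \<noteq> {} \<Longrightarrow> (\<Inter>i\<in>S. min_cell {i}) = min_cell S"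
  by (auto simp: min_cell_def)

end

section \<open>Canonical indices\<close>

lemma bar_length: "length (bar \<nu>) = length \<nu> + 2"
  and bar_first: "bar \<nu> ! 0 = East"
  and bar_last: "bar \<nu> ! Suc (length \<nu>) = North"
  by (simp_all add: bar_def nth_append)

lemma index_mono: "p \<le> q \<Longrightarrow> index u p \<le> index u q"
  by (rule lift_Suc_mono_le) simp_all

text \<open>The index stalls only from the E to the N of a valley, and two valleys never overlap, so
  it cannot stall twice in a row.\<close>

lemma index_less:
  assumes "p < q" "\<not> (q = Suc p \<and> EN_at u p)"
  shows "index u p < index u q"
proof (cases "EN_at u p")
  case False
  then have "index u p < index u (Suc p)" by simp
  also have "\<dots> \<le> index u q" using assms by (intro index_mono) simp
  finally show ?thesis .
next
  case True
  then have "\<not> EN_at u (Suc p)" by (simp add: EN_at_def)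
  then have "index u p < index u (Suc (Suc p))" using True by simp
  also have "\<dots> \<le> index u q" using assms True by (intro index_mono) simp
  finally show ?thesis .
qed

lemma index_less_same_letter:
  assumes "p < q" "u ! p = u ! q"
  shows "index u p < index u q"
  using assms by (intro index_less) (auto simp: EN_at_def)

text \<open>This is what allows conditions on positions in the word to be restated as conditions on
  indices.\<close>

lemma index_le_same_letter_iff:
  assumes "u ! p = u ! q"
  shows "index u p \<le> index u q \<longleftrightarrow> p \<le> q"
  using assms index_mono[of p q u] index_less_same_letter[of q p u] by (auto simp: not_less[symmetric])

text \<open>The index starts at 1 and grows by at most 1 per letter, so it skips nothing.\<close>

lemma index_image: "index u ` {..p} = {1..index u p}"
proof (induction p)
  case (Suc p)
  have "1 \<le> index u p" using index_mono[of 0 p u] by simp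
  then have "{1..Suc (index u p)} = insert (Suc (index u p)) {1..index u p}" by auto
  moreover have "{1..index u p} = insert (index u p) {1..index u p}"
    using \<open>1 \<le> index u p\<close> by auto
  ultimately show ?case using Suc by (simp add: atMost_Suc)
qed simp

text \<open>Going back from the N at \<open>q\<close>, the first E that is met is followed by an
  N.\<close>

lemma EN_at_between:
  assumes "p < q" "q < length u" "u ! p = East" "u ! q = North"
  shows "\<exists>r. p \<le> r \<and> Suc r \<le> q \<and> EN_at u r"
  using assms
proof (induction q)
  case (Suc q)
  show ?case
  proof (cases "u ! q")
    case East
    then show ?thesis using Suc.prems by (intro exI[of _ q]) (auto simp: EN_at_def)
  next
    case North
    then have "p \<noteq> q" using Suc.prems by auto
    then show ?thesis using Suc North by (auto simp: less_Suc_eq)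
  qed
qed simp

lemma max_index_eq: "max_index \<nu> = index (bar \<nu>) (Suc (length \<nu>))"
proof -
  have "{index (bar \<nu>) p |p. p < length (bar \<nu>)} = index (bar \<nu>) ` {..Suc (length \<nu>)}"
    by (auto simp: bar_length less_Suc_eq_le)
  then show ?thesis
    unfolding max_index_def by (intro Max_eqI) (auto intro: index_mono simp del: index.simps)
qed

lemma I_Un_J_set: "I_set \<nu> \<union> J_set \<nu> = {1..max_index \<nu>}"
proof -
  have "I_set \<nu> \<union> J_set \<nu> = index (bar \<nu>) ` {..Suc (length \<nu>)}"
  proof
    show "index (bar \<nu>) ` {..Suc (length \<nu>)} \<subseteq> I_set \<nu> \<union> J_set \<nu>"
    proof
      fix i assume "i \<in> index (bar \<nu>) ` {..Suc (length \<nu>)}"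
      then obtain p where p: "i = index (bar \<nu>) p" "p < length (bar \<nu>)" by (auto simp: bar_length)
      then show "i \<in> I_set \<nu> \<union> J_set \<nu>"
        unfolding I_set_def J_set_def by (cases "bar \<nu> ! p") auto
    qed
  qed (auto simp: I_set_def J_set_def bar_length)
  then show ?thesis by (simp only: index_image max_index_eq)
qed

lemma one_in_I_set: "1 \<in> I_set \<nu>"
  unfolding I_set_def using bar_first[of \<nu>] bar_length[of \<nu>] by (auto intro!: exI[of _ 0])

lemma max_index_in_J_set: "max_index \<nu> \<in> J_set \<nu>"
  unfolding J_set_def max_index_eq using bar_last[of \<nu>] bar_length[of \<nu>]
  by (auto intro!: exI[of _ "Suc (length \<nu>)"])

definition valleys :: "step list \<Rightarrow> nat set" where
  "valleys \<nu> = I_set \<nu> \<inter> J_set \<nu>"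

text \<open>An E and an N can share an index only if they are consecutive in this order, since
  otherwise the index increases strictly between them.\<close>

lemma valleys_eq: "valleys \<nu> = index (bar \<nu>) ` {r. EN_at (bar \<nu>) r}"
proof
  show "valleys \<nu> \<subseteq> index (bar \<nu>) ` {r. EN_at (bar \<nu>) r}"
  proof
    fix i assume "i \<in> valleys \<nu>"
    then obtain p q where pq: "i = index (bar \<nu>) p" "bar \<nu> ! p = East" "i = index (bar \<nu>) q" "bar \<nu> ! q = North"
      unfolding valleys_def I_set_def J_set_def by blast
    have "\<not> q < p" using pq index_less[of q p "bar \<nu>"] by (auto simp: EN_at_def)
    moreover have "p \<noteq> q" using pq by auto
    ultimately have "EN_at (bar \<nu>) p" using pq index_less[of p q "bar \<nu>"] by fastforce
    then show "i \<in> index (bar \<nu>) ` {r. EN_at (bar \<nu>) r}" using pq(1) by blast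
  qed
  show "index (bar \<nu>) ` {r. EN_at (bar \<nu>) r} \<subseteq> valleys \<nu>"
  proof clarify
    fix r assume r: "EN_at (bar \<nu>) r"
    then have "index (bar \<nu>) r \<in> I_set \<nu>" unfolding I_set_def EN_at_def by auto
    moreover have "index (bar \<nu>) (Suc r) \<in> J_set \<nu>" using r unfolding J_set_def EN_at_def by blast
    ultimately show "index (bar \<nu>) r \<in> valleys \<nu>" using r by (simp add: valleys_def)
  qed
qed

lemma finite_valleys: "finite (valleys \<nu>)"
  using I_Un_J_set[of \<nu>] unfolding valleys_def by (metis finite_Int finite_Un finite_atLeastAtMost)

lemma num_valleys_eq: "num_valleys \<nu> = card (valleys \<nu>)"
proof -
  have "inj_on (index (bar \<nu>)) {r. EN_at (bar \<nu>) r}"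
  proof (rule inj_onI)
    fix p q assume *: "p \<in> {r. EN_at (bar \<nu>) r}" "q \<in> {r. EN_at (bar \<nu>) r}"
      and eq: "index (bar \<nu>) p = index (bar \<nu>) q"
    then have "bar \<nu> ! p = bar \<nu> ! q" by (simp add: EN_at_def)
    then show "p = q"
      using eq index_less_same_letter[of p q "bar \<nu>"] index_less_same_letter[of q p "bar \<nu>"]
      by (cases p q rule: linorder_cases) auto
  qed
  then show ?thesis by (simp add: num_valleys_def valleys_eq card_image)
qed

text \<open>An N standing before an E has a strictly smaller index, so \<open>i \<le> j\<close>
  places the E first, and some EN then occurs from the one to the other.\<close>

lemma valley_between:
  assumes "i \<in> I_set \<nu>" "j \<in> J_set \<nu>" "i \<le> j"
  shows "\<exists>v\<in>valleys \<nu>. i \<le> v \<and> v \<le> j"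
proof -
  obtain p where p: "p < length (bar \<nu>)" "bar \<nu> ! p = East" "index (bar \<nu>) p = i"
    using assms(1) unfolding I_set_def by blast
  obtain q where q: "q < length (bar \<nu>)" "bar \<nu> ! q = North" "index (bar \<nu>) q = j"
    using assms(2) unfolding J_set_def by blast
  have "p \<noteq> q" using p q by auto
  then consider "p < q" | "q < p" by linarith
  then show ?thesis
  proof cases
    case 1
    then obtain r where r: "p \<le> r" "Suc r \<le> q" "EN_at (bar \<nu>) r"
      using EN_at_between[OF 1 q(1) p(2) q(2)] by blast
    then have "i \<le> index (bar \<nu>) r" "index (bar \<nu>) r \<le> j"
      using index_mono[of p r "bar \<nu>"] index_mono[of r q "bar \<nu>"] p q by auto
    then show ?thesis using r(3) unfolding valleys_eq by blast
  next
    case 2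
    then have "index (bar \<nu>) q < index (bar \<nu>) p"
      using q(2) by (intro index_less) (auto simp: EN_at_def)
    then show ?thesis using assms(3) p q by simp
  qed
qed

lemma G_edges_iff:
  "(i, j, d) \<in> G_edges \<nu> \<longleftrightarrow> d = Fwd \<and> i \<in> I_set \<nu> \<and> j \<in> J_set \<nu> \<and> i < j
     \<and> (\<forall>v\<in>valleys \<nu>. i \<le> v \<and> v \<le> j \<longrightarrow> v = i \<or> v = j)"
proof -
  have "(\<forall>r. p \<le> r \<and> Suc r \<le> q \<and> EN_at (bar \<nu>) r \<longrightarrow>
          (\<exists>k\<in>{i, j}. index (bar \<nu>) r = k \<and> index (bar \<nu>) (Suc r) = k))
      \<longleftrightarrow> (\<forall>v\<in>valleys \<nu>. i \<le> v \<and> v \<le> j \<longrightarrow> v = i \<or> v = j)"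
    if p: "bar \<nu> ! p = East" "index (bar \<nu>) p = i" and q: "bar \<nu> ! q = North" "index (bar \<nu>) q = j" for p q
  proof -
    \<comment> \<open>The E of the valley is compared with the E at \<open>p\<close> and its N with
      the N at \<open>q\<close>; comparisons of equal letters are faithful, and both letters of the
      valley have the same index.\<close>
    have "p \<le> r \<and> Suc r \<le> q \<longleftrightarrow> i \<le> index (bar \<nu>) r \<and> index (bar \<nu>) r \<le> j" if r: "EN_at (bar \<nu>) r" for r
    proof -
      have "i \<le> index (bar \<nu>) r \<longleftrightarrow> p \<le> r"
        using index_le_same_letter_iff[of "bar \<nu>" p r] p r by (simp add: EN_at_def)
      moreover have "index (bar \<nu>) (Suc r) \<le> j \<longleftrightarrow> Suc r \<le> q"
        using index_le_same_letter_iff[of "bar \<nu>" "Suc r" q] q r by (simp add: EN_at_def)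
      ultimately show ?thesis using r by simp
    qed
    then show ?thesis unfolding valleys_eq by auto
  qed
  then show ?thesis
    unfolding G_edges_def I_set_def J_set_def by blast
qed

section \<open>The blocks of a lattice path\<close>

text \<open>
  The \<open>k\<close>-th block of \<open>bar \<nu>\<close> is the \<open>k\<close>-th maximal factor of the form \<open>E \<dots> E N \<dots> N\<close>; it
  contains exactly one valley.
\<close>

definition E_block :: "step list \<Rightarrow> nat \<Rightarrow> nat" where
  "E_block \<nu> i = Suc (card {v \<in> valleys \<nu>. v < i})"

text \<open>The letters N of a block come after the N of its valley, so the valley at
  \<open>j\<close> itself is counted here, whereas \<open>E_block\<close> counts the valleys
  strictly before \<open>i\<close> and adds one. At a valley both give its number.\<close>

definition N_block :: "step list \<Rightarrow> nat \<Rightarrow> nat" where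
  "N_block \<nu> j = card {v \<in> valleys \<nu>. v \<le> j}"

lemma valley_image: "valley \<nu> ` {1..num_valleys \<nu>} = valleys \<nu>"
proof -
  have "{1..num_valleys \<nu>} = Suc ` {..<card (valleys \<nu>)}"
    unfolding num_valleys_eq image_Suc_lessThan ..
  then have "valley \<nu> ` {1..num_valleys \<nu>} = (!) (sorted_list_of_set (valleys \<nu>)) ` {..<card (valleys \<nu>)}"
    by (simp add: image_image valley_def valleys_def)
  also have "\<dots> = set (sorted_list_of_set (valleys \<nu>))"
    by (auto simp: set_conv_nth)
  finally show ?thesis using finite_valleys by simp
qed

lemma valley_less:
  assumes "1 \<le> k" "k < l" "l \<le> num_valleys \<nu>"
  shows "valley \<nu> k < valley \<nu> l"
  using assms sorted_wrt_nth_less[OF strict_sorted_list_of_set[of "valleys \<nu>"], of "k - 1" "l - 1"]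
  by (simp add: valley_def valleys_def num_valleys_eq)

lemma valley_less_iff:
  assumes "k \<in> {1..num_valleys \<nu>}" "l \<in> {1..num_valleys \<nu>}"
  shows "valley \<nu> k < valley \<nu> l \<longleftrightarrow> k < l"
  using assms valley_less[of k l \<nu>] valley_less[of l k \<nu>] by (cases k l rule: linorder_cases) auto

lemma valley_in_valleys: "k \<in> {1..num_valleys \<nu>} \<Longrightarrow> valley \<nu> k \<in> valleys \<nu>"
  using valley_image by blast

lemma card_valleys_less:
  assumes "k \<in> {1..num_valleys \<nu>}"
  shows "card {v \<in> valleys \<nu>. v < valley \<nu> k} = k - 1"
proof -
  have "{v \<in> valleys \<nu>. v < valley \<nu> k} = valley \<nu> ` {1..<k}"
    using assms valley_less_iff[of _ \<nu> k] unfolding valley_image[symmetric] by auto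
  moreover have "inj_on (valley \<nu>) {1..<k}"
  proof (rule inj_onI)
    fix x y assume "x \<in> {1..<k}" "y \<in> {1..<k}" "valley \<nu> x = valley \<nu> y"
    then show "x = y"
      using assms valley_less[of x y \<nu>] valley_less[of y x \<nu>]
      by (cases x y rule: linorder_cases) auto
  qed
  ultimately show ?thesis by (simp add: card_image)
qed

lemma E_block_valley:
  assumes "k \<in> {1..num_valleys \<nu>}"
  shows "E_block \<nu> (valley \<nu> k) = k"
  using assms card_valleys_less[OF assms] by (simp add: E_block_def)

lemma N_block_valley:
  assumes "k \<in> {1..num_valleys \<nu>}"
  shows "N_block \<nu> (valley \<nu> k) = k"
proof -
  have "{v \<in> valleys \<nu>. v \<le> valley \<nu> k} = insert (valley \<nu> k) {v \<in> valleys \<nu>. v < valley \<nu> k}"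
    using valley_in_valleys[OF assms] by auto
  then show ?thesis
    using assms card_valleys_less[OF assms] finite_valleys by (simp add: N_block_def)
qed

text \<open>The final N of \<open>bar \<nu>\<close> carries the largest index, which ensures a
  valley at or after \<open>i\<close>. The valleys before \<open>i\<close> are those before the
  least such valley, so \<open>E_block\<close> is the number of that valley.\<close>

lemma E_block_least:
  assumes "i \<in> I_set \<nu>"
  shows "E_block \<nu> i \<in> {1..num_valleys \<nu>}" "i \<le> valley \<nu> (E_block \<nu> i)"
    and "\<And>v. v \<in> valleys \<nu> \<Longrightarrow> i \<le> v \<Longrightarrow> valley \<nu> (E_block \<nu> i) \<le> v"
proof -
  let ?A = "{v \<in> valleys \<nu>. i \<le> v}"
  have "i \<le> max_index \<nu>" using assms I_Un_J_set[of \<nu>] by auto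
  then have ne: "?A \<noteq> {}" using valley_between[OF assms max_index_in_J_set] by blast
  have fin: "finite ?A" using finite_valleys by simp
  have m: "Min ?A \<in> ?A" "\<And>v. v \<in> ?A \<Longrightarrow> Min ?A \<le> v"
    by (rule Min_in[OF fin ne], rule Min_le[OF fin])
  then obtain k where k: "k \<in> {1..num_valleys \<nu>}" "Min ?A = valley \<nu> k"
    using valley_image[of \<nu>] by blast
  have "{v \<in> valleys \<nu>. v < i} = {v \<in> valleys \<nu>. v < valley \<nu> k}"
    using m k(2) by force
  then have "E_block \<nu> i = k" using E_block_valley[OF k(1)] by (simp add: E_block_def)
  then show "E_block \<nu> i \<in> {1..num_valleys \<nu>}" "i \<le> valley \<nu> (E_block \<nu> i)"
    and "\<And>v. v \<in> valleys \<nu> \<Longrightarrow> i \<le> v \<Longrightarrow> valley \<nu> (E_block \<nu> i) \<le> v"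
    using m k by auto
qed

text \<open>Dually, the initial E of \<open>bar \<nu>\<close> carries index 1, which ensures a
  valley at or before \<open>j\<close>.\<close>

lemma N_block_greatest:
  assumes "j \<in> J_set \<nu>"
  shows "N_block \<nu> j \<in> {1..num_valleys \<nu>}" "valley \<nu> (N_block \<nu> j) \<le> j"
    and "\<And>v. v \<in> valleys \<nu> \<Longrightarrow> v \<le> j \<Longrightarrow> v \<le> valley \<nu> (N_block \<nu> j)"
proof -
  let ?A = "{v \<in> valleys \<nu>. v \<le> j}"
  have "1 \<le> j" using assms I_Un_J_set[of \<nu>] by auto
  then have ne: "?A \<noteq> {}" using valley_between[OF one_in_I_set assms] by blast
  have fin: "finite ?A" using finite_valleys by simp
  have m: "Max ?A \<in> ?A" "\<And>v. v \<in> ?A \<Longrightarrow> v \<le> Max ?A"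
    by (rule Max_in[OF fin ne], rule Max_ge[OF fin])
  then obtain k where k: "k \<in> {1..num_valleys \<nu>}" "Max ?A = valley \<nu> k"
    using valley_image[of \<nu>] by blast
  have "{v \<in> valleys \<nu>. v \<le> j} = {v \<in> valleys \<nu>. v \<le> valley \<nu> k}"
    using m k(2) by force
  then have "N_block \<nu> j = k" using N_block_valley[OF k(1)] by (simp add: N_block_def)
  then show "N_block \<nu> j \<in> {1..num_valleys \<nu>}" "valley \<nu> (N_block \<nu> j) \<le> j"
    and "\<And>v. v \<in> valleys \<nu> \<Longrightarrow> v \<le> j \<Longrightarrow> v \<le> valley \<nu> (N_block \<nu> j)"
    using m k by auto
qed

lemma num_valleys_pos: "1 \<le> num_valleys \<nu>"
  using E_block_least(1)[OF one_in_I_set, of \<nu>] by auto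

interpretation path: valley_tree "max_index \<nu>" "num_valleys \<nu>" "I_set \<nu>" "J_set \<nu>" "valley \<nu>"
  "E_block \<nu>" "N_block \<nu>" for \<nu>
proof
  show "I_set \<nu> \<inter> J_set \<nu> = valley \<nu> ` {1..num_valleys \<nu>}"
    unfolding valley_image by (simp add: valleys_def)
qed (simp_all only: I_Un_J_set num_valleys_pos E_block_least(1) N_block_greatest(1) E_block_valley N_block_valley)

text \<open>The interval between the endpoints of an edge contains a valley by
  \<open>valley_between\<close>, but only endpoints may be valleys. So a lower endpoint that is no
  valley is joined to the next valley, an upper one to the previous valley, and two valleys must be
  consecutive.\<close>

lemma G_edges_eq:
  "G_edges \<nu> = (\<lambda>i. (i, valley \<nu> (E_block \<nu> i), Fwd)) ` (I_set \<nu> - J_set \<nu>)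
     \<union> (\<lambda>j. (valley \<nu> (N_block \<nu> j), j, Fwd)) ` (J_set \<nu> - I_set \<nu>) \<union> path.valley_path \<nu> Fwd"
    (is "_ = ?A \<union> ?B \<union> ?C")
proof
  show "G_edges \<nu> \<subseteq> ?A \<union> ?B \<union> ?C"
  proof
    fix e assume "e \<in> G_edges \<nu>"
    obtain i j d where e: "e = (i, j, d)" by (cases e)
    from \<open>e \<in> G_edges \<nu>\<close> have *: "d = Fwd" "i \<in> I_set \<nu>" "j \<in> J_set \<nu>" "i < j"
      "\<And>v. v \<in> valleys \<nu> \<Longrightarrow> i \<le> v \<Longrightarrow> v \<le> j \<Longrightarrow> v = i \<or> v = j"
      unfolding e G_edges_iff by auto
    show "e \<in> ?A \<union> ?B \<union> ?C"
    proof (cases "i \<in> valleys \<nu>")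
      case False
      let ?v = "valley \<nu> (E_block \<nu> i)"
      have v: "?v \<in> valleys \<nu>" "i \<le> ?v"
        using E_block_least[OF *(2)] valley_in_valleys by blast+
      have "?v \<le> j" using valley_between[OF *(2,3)] *(4) E_block_least(3)[OF *(2)] by fastforce
      then have "?v = j" using *(5)[of ?v] v False by auto
      then show ?thesis using e *(1,2) False by (auto simp: valleys_def)
    next
      case iV: True
      show ?thesis
      proof (cases "j \<in> valleys \<nu>")
        case False
        let ?v = "valley \<nu> (N_block \<nu> j)"
        have v: "?v \<in> valleys \<nu>" "?v \<le> j"
          using N_block_greatest[OF *(3)] valley_in_valleys by blast+
        have "i \<le> ?v" using N_block_greatest(3)[OF *(3) iV] *(4) by simp
        then have "?v = i" using *(5)[of ?v] v False by auto
        then show ?thesis using e *(1,3) False by (auto simp: valleys_def)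
      next
        case True
        obtain k where k: "k \<in> {1..num_valleys \<nu>}" "i = valley \<nu> k" using iV valley_image by blast
        obtain l where l: "l \<in> {1..num_valleys \<nu>}" "j = valley \<nu> l" using True valley_image by blast
        have kl: "k < l" using *(4) k l valley_less_iff by blast
        have "l = Suc k"
        proof (rule ccontr)
          assume "l \<noteq> Suc k"
          then have "Suc k \<in> {1..num_valleys \<nu>}" "Suc k < l" using kl l by auto
          then have "i < valley \<nu> (Suc k)" "valley \<nu> (Suc k) < j" "valley \<nu> (Suc k) \<in> valleys \<nu>"
            using k l valley_less_iff valley_in_valleys by auto
          then show False using *(5)[of "valley \<nu> (Suc k)"] by simp
        qed
        then show ?thesis using e *(1) k l kl by (auto simp: path.valley_path_def)
      qed
    qed
  qed
  have "e \<in> G_edges \<nu>" if e: "e \<in> ?A" for e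
  proof -
    obtain i where i: "i \<in> I_set \<nu>" "i \<notin> J_set \<nu>" "e = (i, valley \<nu> (E_block \<nu> i), Fwd)"
      using e by blast
    note b = E_block_least[OF i(1)]
    have "valley \<nu> (E_block \<nu> i) \<in> valleys \<nu>" using valley_in_valleys b(1) by blast
    moreover have "i \<noteq> valley \<nu> (E_block \<nu> i)" using calculation i(2) by (auto simp: valleys_def)
    ultimately show ?thesis
      using i(1) b(2) b(3) unfolding i(3) G_edges_iff by (auto simp: valleys_def intro: antisym)
  qed
  moreover have "e \<in> G_edges \<nu>" if e: "e \<in> ?B" for e
  proof -
    obtain j where j: "j \<in> J_set \<nu>" "j \<notin> I_set \<nu>" "e = (valley \<nu> (N_block \<nu> j), j, Fwd)"
      using e by blast
    note b = N_block_greatest[OF j(1)]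
    have "valley \<nu> (N_block \<nu> j) \<in> valleys \<nu>" using valley_in_valleys b(1) by blast
    moreover have "j \<noteq> valley \<nu> (N_block \<nu> j)" using calculation j(2) by (auto simp: valleys_def)
    ultimately show ?thesis
      using j(1) b(2) b(3) unfolding j(3) G_edges_iff by (auto simp: valleys_def intro: antisym)
  qed
  moreover have "e \<in> G_edges \<nu>" if e: "e \<in> ?C" for e
  proof -
    obtain k where k: "k \<in> {1..<num_valleys \<nu>}" "e = (valley \<nu> k, valley \<nu> (Suc k), Fwd)"
      using e unfolding path.valley_path_def by blast
    then have r: "k \<in> {1..num_valleys \<nu>}" "Suc k \<in> {1..num_valleys \<nu>}" by auto
    have "v = valley \<nu> k \<or> v = valley \<nu> (Suc k)"
      if v: "v \<in> valleys \<nu>" "valley \<nu> k \<le> v" "v \<le> valley \<nu> (Suc k)" for v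
    proof -
      obtain l where l: "l \<in> {1..num_valleys \<nu>}" "v = valley \<nu> l" using v(1) valley_image by blast
      have "\<not> l < k" "\<not> Suc k < l"
        using v valley_less_iff[OF l(1) r(1)] valley_less_iff[OF r(2) l(1)] l(2) by auto
      then have "l = k \<or> l = Suc k" by auto
      then show ?thesis using l(2) by auto
    qed
    then show ?thesis
      using valley_in_valleys[OF r(1)] valley_in_valleys[OF r(2)] valley_less_iff[OF r]
      unfolding k(2) G_edges_iff by (auto simp: valleys_def)
  qed
  ultimately show "?A \<union> ?B \<union> ?C \<subseteq> G_edges \<nu>" by blast
qed

lemma GB_edges_eq:
  "GB_edges \<nu> = (\<lambda>i. (i, valley \<nu> (E_block \<nu> i), Fwd)) ` (I_set \<nu> - J_set \<nu>)
     \<union> (\<lambda>j. (valley \<nu> (N_block \<nu> j), j, Fwd)) ` (J_set \<nu> - I_set \<nu>) \<union> path.valley_path \<nu> Bidir"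
proof -
  let ?t = "\<lambda>i j. if i \<in> I_set \<nu> \<inter> J_set \<nu> \<and> j \<in> I_set \<nu> \<inter> J_set \<nu> then Bidir else Fwd"
  have "GB_edges \<nu> = (\<lambda>(i, j, d). (i, j, ?t i j)) ` G_edges \<nu>"
  proof (intro equalityI subsetI)
    fix e assume "e \<in> GB_edges \<nu>"
    then obtain i j where "e = (i, j, ?t i j)" "(i, j, Fwd) \<in> G_edges \<nu>"
      unfolding GB_edges_def by blast
    then show "e \<in> (\<lambda>(i, j, d). (i, j, ?t i j)) ` G_edges \<nu>"
      by (intro image_eqI[of _ _ "(i, j, Fwd)"]) simp_all
  next
    fix e assume "e \<in> (\<lambda>(i, j, d). (i, j, ?t i j)) ` G_edges \<nu>"
    then obtain x where x: "x \<in> G_edges \<nu>" "e = (case x of (i, j, d) \<Rightarrow> (i, j, ?t i j))" by blast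
    obtain i j d where "x = (i, j, d)" by (cases x)
    then have "(i, j, d) \<in> G_edges \<nu>" and e: "e = (i, j, ?t i j)" using x by simp_all
    then have "(i, j, Fwd) \<in> G_edges \<nu>" unfolding G_edges_iff by blast
    then show "e \<in> GB_edges \<nu>" unfolding GB_edges_def e by blast
  qed
  moreover have "(\<lambda>(i, j, d). (i, j, ?t i j)) ` path.valley_path \<nu> Fwd = path.valley_path \<nu> Bidir"
    unfolding path.valley_path_def image_image
    by (rule image_cong) (simp_all add: path.val_in_I path.val_in_J)
  moreover have "(\<lambda>(i, j, d). (i, j, ?t i j)) ` (\<lambda>i. (i, valley \<nu> (E_block \<nu> i), Fwd)) ` (I_set \<nu> - J_set \<nu>)
      = (\<lambda>i. (i, valley \<nu> (E_block \<nu> i), Fwd)) ` (I_set \<nu> - J_set \<nu>)"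
    unfolding image_image by (rule image_cong) simp_all
  moreover have "(\<lambda>(i, j, d). (i, j, ?t i j)) ` (\<lambda>j. (valley \<nu> (N_block \<nu> j), j, Fwd)) ` (J_set \<nu> - I_set \<nu>)
      = (\<lambda>j. (valley \<nu> (N_block \<nu> j), j, Fwd)) ` (J_set \<nu> - I_set \<nu>)"
    unfolding image_image by (rule image_cong) simp_all
  ultimately show ?thesis
    unfolding G_edges_eq image_Un by (simp only:)
qed

section \<open>The augmented graphs and the final assembly\<close>

lemma aug_edges_GB: "aug_edges \<nu> (GB_edges \<nu>) = path.pendant_edges \<nu> \<union> path.valley_path \<nu> Bidir"
  unfolding aug_edges_def GB_edges_eq path.pendant_edges_def by auto

lemma aug_edges_G: "aug_edges \<nu> (G_edges \<nu>) = path.pendant_edges \<nu> \<union> path.valley_path \<nu> Fwd"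
  unfolding aug_edges_def G_edges_eq path.pendant_edges_def by auto

text \<open>The deleted edge is not pendant, so deletion commutes with augmentation; for the last
  index the cut cycle is the forward path itself.\<close>

lemma aug_edges_Gi:
  assumes "i \<in> {1..num_valleys \<nu>}"
  shows "aug_edges \<nu> (Gi_edges \<nu> i) = path.pendant_edges \<nu> \<union> path.cut_cycle \<nu> {i}"
proof (cases "i < num_valleys \<nu>")
  case True
  let ?e = "(valley \<nu> i, valley \<nu> (Suc i), Fwd)"
  let ?b = "(valley \<nu> 1, valley \<nu> (num_valleys \<nu>), Bwd)"
  have "?e \<in> path.valley_path \<nu> Fwd" using True assms by (auto simp: path.valley_path_def)
  then have e: "?e \<notin> path.pendant_edges \<nu>"
    using path.valley_edges_disjoint[OF path.valley_edges_valley_path] by blast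
  define X where "X = {(0, i, Fwd) |i. i \<in> I_set \<nu>} \<union> {(j, max_index \<nu> + 1, Fwd) |j. j \<in> J_set \<nu>}"
  have aug: "aug_edges \<nu> H = H \<union> X" for H
    unfolding aug_edges_def X_def by (simp only: Un_assoc)
  have "X \<subseteq> path.pendant_edges \<nu>"
    unfolding X_def path.pendant_edges_def by auto
  then have "aug_edges \<nu> (Gi_edges \<nu> i) = (aug_edges \<nu> (G_edges \<nu>) - {?e}) \<union> {?b}"
    unfolding aug using e True by (auto simp: Gi_edges_def)
  moreover have "path.cut_cycle \<nu> {i} = (path.valley_path \<nu> Fwd - {?e}) \<union> {?b}"
  proof -
    have "{1..num_valleys \<nu>} - {i} = insert (num_valleys \<nu>) ({1..<num_valleys \<nu>} - {i})"
      using True assms by auto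
    moreover have "path.valley_path \<nu> Fwd - {?e} = path.cycle_edge \<nu> ` ({1..<num_valleys \<nu>} - {i})"
      using assms path.val_eq_iff[of _ \<nu> i]
      by (auto simp: path.valley_path_def path.cycle_edge_def)
    ultimately show ?thesis by (simp add: path.cut_cycle_def) (simp add: path.cycle_edge_def)
  qed
  ultimately show ?thesis unfolding aug_edges_G using e by blast
next
  case False
  then have "i = num_valleys \<nu>" using assms by simp
  then show ?thesis by (simp add: Gi_edges_def aug_edges_G path.cut_cycle_last)
qed

lemma aug_verts_eq: "aug_verts \<nu> = {0..Suc (max_index \<nu>)}"
  by (simp add: aug_verts_def)

text \<open>For \<open>i < w\<close> both sides are hulls of the same routes; for the last index
  both are the forward flows written in bidirectional coordinates.\<close>

lemma cell_eq_min_cell: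
  assumes "i \<in> {1..num_valleys \<nu>}"
  shows "cell \<nu> i = path.min_cell \<nu> {i}"
proof (cases "i < num_valleys \<nu>")
  case True
  have "cell_routes \<nu> i = {R \<in> path.bidir_routes \<nu>. char_vec R \<in> path.min_cell \<nu> {i}}"
    unfolding cell_routes_def aug_verts_eq aug_edges_GB
    using path.char_vec_in_min_cell_iff[of i \<nu>] assms True by auto
  then show ?thesis
    using True path.min_cell_hull[of "{i}" \<nu>] assms by (simp add: cell_def)
next
  case False
  then have i: "i = num_valleys \<nu>" using assms by simp
  show ?thesis
    unfolding i path.min_cell_last path.cut_cycle_last
    by (simp add: cell_def aug_verts_eq aug_edges_GB aug_edges_G)
qed

theorem theorem1p1:
  fixes a b w :: nat and \<nu> :: "step list"
  assumes "lattice_path a b \<nu>"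
    and "w = num_valleys \<nu>"
  shows "flow_polytope (aug_verts \<nu>) (aug_edges \<nu> (GB_edges \<nu>)) = (\<Union>i\<in>{1..w}. cell \<nu> i)
    \<and> (\<forall>i\<in>{1..w}. polytope (cell \<nu> i))
    \<and> disjoint_family_on (\<lambda>i. rel_interior (cell \<nu> i)) {1..w}
    \<and> (\<forall>S. S \<noteq> {} \<and> S \<subseteq> {1..w} \<longrightarrow>
           integrally_equivalent (\<Inter>i\<in>S. cell \<nu> i)
             (flow_polytope (aug_verts \<nu>) (\<Inter>i\<in>S. aug_edges \<nu> (Gi_edges \<nu> i))))"
proof (intro conjI allI impI ballI)
  note w = assms(2)
  have cell: "cell \<nu> i = path.min_cell \<nu> {i}" if "i \<in> {1..w}" for i
    using cell_eq_min_cell that w by simp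
  show "flow_polytope (aug_verts \<nu>) (aug_edges \<nu> (GB_edges \<nu>)) = (\<Union>i\<in>{1..w}. cell \<nu> i)"
    unfolding aug_verts_eq aug_edges_GB path.bidir_polytope_eq_Union w
    using cell by (simp add: w)
  show "polytope (cell \<nu> i)" if "i \<in> {1..w}" for i
    using path.polytope_min_cell[of "{i}" \<nu>] that w by (simp add: cell)
  show "disjoint_family_on (\<lambda>i. rel_interior (cell \<nu> i)) {1..w}"
    using path.disjoint_rel_interior_min_cell[of \<nu>] cell by (simp add: disjoint_family_on_def w)
  fix S assume S: "S \<noteq> {} \<and> S \<subseteq> {1..w}"
  then have "(\<Inter>i\<in>S. cell \<nu> i) = (\<Inter>i\<in>S. path.min_cell \<nu> {i})"
    using cell by (intro INF_cong) auto
  then have "(\<Inter>i\<in>S. cell \<nu> i) = path.min_cell \<nu> S"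
    using S path.Inter_min_cell by simp
  moreover have "(\<Inter>i\<in>S. aug_edges \<nu> (Gi_edges \<nu> i)) = (\<Inter>i\<in>S. path.pendant_edges \<nu> \<union> path.cut_cycle \<nu> {i})"
    using S aug_edges_Gi[of _ \<nu>] w by (intro INF_cong) auto
  then have "(\<Inter>i\<in>S. aug_edges \<nu> (Gi_edges \<nu> i)) = path.pendant_edges \<nu> \<union> path.cut_cycle \<nu> S"
    using S w path.Inter_cut_cycle[of S \<nu>] by simp
  ultimately show "integrally_equivalent (\<Inter>i\<in>S. cell \<nu> i)
      (flow_polytope (aug_verts \<nu>) (\<Inter>i\<in>S. aug_edges \<nu> (Gi_edges \<nu> i)))"
    using path.min_cell_integrally_equivalent[of S \<nu>] S w by (simp add: aug_verts_eq)
qed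

end
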